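(* Let $k$ be an algebraically closed field of characteristic $p=2$, let $X$ be a connected smooth projective curve over $k$ of genus $g_X\ge 2$, and let $G$ be a finite subgroup of $\mathrm{Aut}(X)$ whose order is a power of $2$. Suppose that $\pi: X\to Y=X/G$ is weakly ramified, i.e. $G_i(P)$ is trivial for all $P\in X$ and all $i\ge 2$. Let $P\in X$ be a ramified point of $\pi$ such that $G(P)$ is not cyclic. Then the smallest odd pole number $m$ at $P$ is congruent to $1$ modulo $4$, and $m-1$ is a pole number at $P$ as well.
   Context: For $P\in X$, $G(P)=\{g\in G: g(P)=P\}$ is the decomposition group; $P$ is ramified if $G(P)$ is non-trivial. For $i\ge 0$ and a local parameter $t_P$ at $P$, $G_i(P)=\{g\in G(P): g(t_P)-t_P\in (t_P^{i+1})\}$ is the $i$-th ramification group (lower numbering). A natural number $m$ is called a pole number at $P\in X$ if there exists a meromorphic function on $X$ whose pole order at $P$ is $m$ and which is holomorphic everywhere else. (Every integer $m>2g_X-2$ is a pole number at $P$.) *)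

theory Defs
  imports
    "HOL-Analysis.Abstract_Limits"
    "HOL-Computational_Algebra.Polynomial"
    "HOL-Number_Theory.Cong"
    "HOL-Algebra.Bij"
    "HOL-Algebra.Elementary_Groups"
begin

section \<open>Projective space and its Zariski topology\<close>

text \<open>
  Everything takes place over an algebraically closed field \<open>'k\<close>, in the projective space with
  homogeneous coordinates indexed by the finite type \<open>'n\<close>, that is, of dimension \<open>CARD('n) - 1\<close>.
  A point is the set of all its vectors of homogeneous coordinates. Since \<open>'k\<close> is infinite,
  homogeneous polynomials are identified with the functions they induce on \<open>'n \<Rightarrow> 'k\<close>; as usual,
  the zero polynomial is homogeneous of every degree.
\<close>

type_synonym ('n, 'k) point = "('n \<Rightarrow> 'k) set"

definition point_of :: "('n \<Rightarrow> 'k::field) \<Rightarrow> ('n, 'k) point" where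
  "point_of x = {\<lambda>i. c * x i |c. c \<noteq> 0}"

definition proj_space :: "('n, 'k::field) point set" where
  "proj_space = point_of ` {x. \<exists>i. x i \<noteq> 0}"

inductive homogeneous :: "nat \<Rightarrow> (('n \<Rightarrow> 'k::field) \<Rightarrow> 'k) \<Rightarrow> bool" where
  const: "homogeneous 0 (\<lambda>_. c)"
| coord: "homogeneous d F \<Longrightarrow> homogeneous (Suc d) (\<lambda>x. x i * F x)"
| add: "homogeneous d F \<Longrightarrow> homogeneous d G \<Longrightarrow> homogeneous d (\<lambda>x. F x + G x)"

definition zero_locus :: "(('n \<Rightarrow> 'k::field) \<Rightarrow> 'k) set \<Rightarrow> ('n, 'k) point set" where
  "zero_locus S = {P \<in> proj_space. \<forall>F\<in>S. \<forall>x\<in>P. F x = 0}"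

definition algebraic_set :: "('n, 'k::field) point set \<Rightarrow> bool" where
  "algebraic_set Z \<longleftrightarrow> (\<exists>S. (\<forall>F\<in>S. \<exists>d. homogeneous d F) \<and> Z = zero_locus S)"

definition zariski :: "('n, 'k::field) point topology" where
  "zariski = topology (\<lambda>U. U \<subseteq> proj_space \<and> algebraic_set (proj_space - U))"

lemma homogeneous_scale:
  "homogeneous d F \<Longrightarrow> F (\<lambda>i. c * x i) = c ^ d * F x"
  by (induction rule: homogeneous.induct) (simp_all add: algebra_simps)

lemma homogeneous_cmult: "homogeneous d F \<Longrightarrow> homogeneous d (\<lambda>x. c * F x)"
proof (induction rule: homogeneous.induct)
  case (const b)
  show ?case by (rule homogeneous.const)
next
  case (coord d F i)
  from homogeneous.coord[OF coord.IH, of i] show ?case by (simp add: mult.left_commute)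
next
  case (add d F G)
  from homogeneous.add[OF add.IH] show ?case by (simp add: distrib_left)
qed

lemma homogeneous_mult:
  assumes "homogeneous d F" "homogeneous e G"
  shows "homogeneous (d + e) (\<lambda>x. F x * G x)"
  using assms(1)
proof (induction rule: homogeneous.induct)
  case (const c)
  show ?case using homogeneous_cmult[OF assms(2)] by simp
next
  case (coord d F i)
  from homogeneous.coord[OF coord.IH, of i] show ?case by (simp add: mult.assoc)
next
  case (add d F H)
  from homogeneous.add[OF add.IH] show ?case by (simp add: distrib_right)
qed

lemma homogeneous_zero_on_point:
  assumes "homogeneous d F" "P \<in> proj_space" "x \<in> P" "y \<in> P" "F x = 0"
  shows "F y = 0"
proof -
  from assms(2) obtain z where P: "P = point_of z"
    by (auto simp: proj_space_def)
  from assms(3,4) P obtain a b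
    where "a \<noteq> 0" "x = (\<lambda>i. a * z i)" and y: "y = (\<lambda>i. b * z i)"
    by (auto simp: point_of_def)
  with assms(5) homogeneous_scale[OF assms(1)] have "F z = 0"
    by simp
  then show ?thesis
    by (simp add: y homogeneous_scale[OF assms(1)])
qed

lemma point_nonempty: "P \<in> proj_space \<Longrightarrow> \<exists>x. x \<in> P"
  unfolding proj_space_def point_of_def by (auto intro!: exI[of _ "1::'b::field"])

lemma algebraic_set_Inter:
  assumes "\<K> \<noteq> {}" "\<And>Z. Z \<in> \<K> \<Longrightarrow> algebraic_set Z"
  shows "algebraic_set (\<Inter>\<K>)"
proof -
  from assms(2) obtain S
    where S: "\<And>Z. Z \<in> \<K> \<Longrightarrow> (\<forall>F\<in>S Z. \<exists>d. homogeneous d F) \<and> Z = zero_locus (S Z)"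
    unfolding algebraic_set_def by metis
  have "(\<Inter>Z\<in>\<K>. Z) = (\<Inter>Z\<in>\<K>. zero_locus (S Z))"
    by (intro INF_cong refl) (use S in metis)
  also have "\<dots> = zero_locus (\<Union>(S ` \<K>))"
    using assms(1) by (auto simp: zero_locus_def)
  finally have "\<Inter>\<K> = zero_locus (\<Union>(S ` \<K>))"
    by simp
  moreover have "\<exists>d. homogeneous d F" if "F \<in> \<Union>(S ` \<K>)" for F
    using that S by (metis UN_E)
  ultimately show ?thesis
    unfolding algebraic_set_def by blast
qed

lemma algebraic_set_Un:
  assumes "algebraic_set Z" "algebraic_set W"
  shows "algebraic_set (Z \<union> W)"
proof -
  obtain S where S: "\<And>F. F \<in> S \<Longrightarrow> \<exists>d. homogeneous d F" and Z: "Z = zero_locus S"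
    using assms(1) unfolding algebraic_set_def by blast
  obtain T where T: "\<And>F. F \<in> T \<Longrightarrow> \<exists>d. homogeneous d F" and W: "W = zero_locus T"
    using assms(2) unfolding algebraic_set_def by blast
  define R where "R = {\<lambda>x. F x * G x |F G. F \<in> S \<and> G \<in> T}"
  have "Z \<union> W = zero_locus R"
  proof (intro equalityI subsetI)
    fix P assume "P \<in> Z \<union> W"
    then show "P \<in> zero_locus R"
      by (auto simp: Z W R_def zero_locus_def)
  next
    fix P assume P: "P \<in> zero_locus R"
    then have Pn: "P \<in> proj_space" by (simp add: zero_locus_def)
    show "P \<in> Z \<union> W"
    proof (rule ccontr)
      assume "P \<notin> Z \<union> W"
      then obtain F x G y where *: "F \<in> S" "x \<in> P" "F x \<noteq> 0" "G \<in> T" "y \<in> P" "G y \<noteq> 0"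
        using Pn by (auto simp: Z W zero_locus_def)
      have "(\<lambda>x. F x * G x) \<in> R"
        using *(1,4) unfolding R_def by blast
      moreover have "\<forall>H\<in>R. \<forall>x\<in>P. H x = 0"
        using P by (simp add: zero_locus_def)
      ultimately have "F x * G x = 0"
        using *(2) by (metis (no_types, lifting))
      with *(3) have "G x = 0" by simp
      moreover from T[OF *(4)] obtain d where "homogeneous d G" by blast
      ultimately have "G y = 0"
        using homogeneous_zero_on_point[OF _ Pn *(2,5)] by metis
      with *(6) show False by simp
    qed
  qed
  moreover have "\<exists>d. homogeneous d H" if "H \<in> R" for H
  proof -
    from that obtain F G where H: "F \<in> S" "G \<in> T" "H = (\<lambda>x. F x * G x)"
      by (auto simp: R_def)
    from S[OF H(1)] T[OF H(2)] obtain d e where "homogeneous d F" "homogeneous e G"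
      by metis
    then have "homogeneous (d + e) H"
      unfolding H(3) by (rule homogeneous_mult)
    then show ?thesis ..
  qed
  ultimately show ?thesis
    unfolding algebraic_set_def by blast
qed

lemma algebraic_set_empty: "algebraic_set {}"
  unfolding algebraic_set_def
proof (intro exI[of _ "{\<lambda>_. 1}"] conjI ballI)
  show "{} = zero_locus {\<lambda>_. 1}"
    using point_nonempty by (auto simp: zero_locus_def)
qed (auto intro: homogeneous.const)

lemma algebraic_set_proj_space: "algebraic_set proj_space"
  unfolding algebraic_set_def by (intro exI[of _ "{}"]) (auto simp: zero_locus_def)

lemma openin_zariski:
  fixes U :: "('n, 'k::field) point set"
  shows "openin zariski U \<longleftrightarrow> U \<subseteq> proj_space \<and> algebraic_set (proj_space - U)"
proof -
  have "istopology (\<lambda>U::('n, 'k) point set. U \<subseteq> proj_space \<and> algebraic_set (proj_space - U))"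
    unfolding istopology_def
  proof (intro conjI allI impI; (elim conjE)?)
    fix U V :: "('n, 'k) point set"
    assume "U \<subseteq> proj_space" "algebraic_set (proj_space - U)" "algebraic_set (proj_space - V)"
    then show "U \<inter> V \<subseteq> proj_space" "algebraic_set (proj_space - U \<inter> V)"
      using algebraic_set_Un[of "proj_space - U" "proj_space - V"] by (auto simp: Diff_Int)
  next
    fix \<K> :: "('n, 'k) point set set"
    assume K: "\<forall>U\<in>\<K>. U \<subseteq> proj_space \<and> algebraic_set (proj_space - U)"
    then show "\<Union>\<K> \<subseteq> proj_space" by blast
    show "algebraic_set (proj_space - \<Union>\<K>)"
    proof (cases "\<K> = {}")
      case False
      then have "proj_space - \<Union>\<K> = \<Inter>((\<lambda>U. proj_space - U) ` \<K>)"
        by blast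
      then show ?thesis
        using algebraic_set_Inter[of "(\<lambda>U. proj_space - U) ` \<K>"] False K by auto
    qed (simp add: algebraic_set_proj_space)
  qed
  then show ?thesis
    by (simp add: zariski_def topology_inverse')
qed

lemma topspace_zariski: "topspace zariski = proj_space"
  using algebraic_set_empty unfolding topspace_def openin_zariski by force

abbreviation zar :: "('n, 'k::field) point set \<Rightarrow> ('n, 'k) point topology" where
  "zar X \<equiv> subtopology zariski X"


section \<open>Dimension, local rings, smooth projective curves\<close>

definition irreducible_set :: "('n, 'k::field) point set \<Rightarrow> bool" where
  "irreducible_set Z \<longleftrightarrow> Z \<noteq> {} \<and>
     (\<forall>A B. closedin zariski A \<longrightarrow> closedin zariski B \<longrightarrow> Z \<subseteq> A \<union> B \<longrightarrow> Z \<subseteq> A \<or> Z \<subseteq> B)"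

definition has_chain :: "('n, 'k::field) point set \<Rightarrow> nat \<Rightarrow> bool" where
  "has_chain X d \<longleftrightarrow> (\<exists>Z :: nat \<Rightarrow> ('n, 'k) point set.
     (\<forall>i\<le>d. closedin (zar X) (Z i) \<and> irreducible_set (Z i)) \<and> (\<forall>i<d. Z i \<subset> Z (Suc i)))"

definition has_dimension :: "('n, 'k::field) point set \<Rightarrow> nat \<Rightarrow> bool" where
  "has_dimension X d \<longleftrightarrow> has_chain X d \<and> \<not> has_chain X (Suc d)"

text \<open>
  Regular functions at \<open>P\<close> are represented by functions on all points, of which only the germ at
  \<open>P\<close> matters: two of them define the same element of the local ring at \<open>P\<close> iff they agree
  eventually with respect to the filter \<^term>\<open>nhdsin (zar X) P\<close>.
\<close>

definition regular_at ::
    "('n, 'k::field) point set \<Rightarrow> ('n, 'k) point \<Rightarrow> (('n, 'k) point \<Rightarrow> 'k) \<Rightarrow> bool" where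
  "regular_at X P f \<longleftrightarrow> (\<exists>d F G. homogeneous d F \<and> homogeneous d G \<and>
     eventually (\<lambda>Q. \<forall>x\<in>Q. G x \<noteq> 0 \<and> f Q = F x / G x) (nhdsin (zar X) P))"

text \<open>The ideal of the local ring at \<open>P\<close> that is generated by the germ of \<open>t\<close>.\<close>

definition local_ideal ::
    "('n, 'k::field) point set \<Rightarrow> ('n, 'k) point \<Rightarrow> (('n, 'k) point \<Rightarrow> 'k) \<Rightarrow>
     (('n, 'k) point \<Rightarrow> 'k) set" where
  "local_ideal X P t = {f. regular_at X P f \<and>
     (\<exists>h. regular_at X P h \<and> eventually (\<lambda>Q. f Q = t Q * h Q) (nhdsin (zar X) P))}"

definition maximal_ideal_at ::
    "('n, 'k::field) point set \<Rightarrow> ('n, 'k) point \<Rightarrow> (('n, 'k) point \<Rightarrow> 'k) set" where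
  "maximal_ideal_at X P = {f. regular_at X P f \<and> f P = 0}"

definition local_parameter ::
    "('n, 'k::field) point set \<Rightarrow> ('n, 'k) point \<Rightarrow> (('n, 'k) point \<Rightarrow> 'k) \<Rightarrow> bool" where
  "local_parameter X P t \<longleftrightarrow> regular_at X P t \<and> local_ideal X P t = maximal_ideal_at X P"

text \<open>
  Over an algebraically closed field, smoothness at \<open>P\<close> means that the local ring at \<open>P\<close> is
  regular, i.e. that its maximal ideal can be generated by as many elements as its dimension,
  which is 1 for a connected curve.
\<close>

definition smooth_projective_curve :: "('n::finite, 'k::alg_closed_field) point set \<Rightarrow> bool" where
  "smooth_projective_curve X \<longleftrightarrow>
     closedin zariski X \<and> connectedin zariski X \<and> has_dimension X 1 \<and>
     (\<forall>P\<in>X. \<exists>t. local_parameter X P t)"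


section \<open>Meromorphic functions, pole numbers, genus\<close>

text \<open>
  Meromorphic (i.e. rational) functions are again represented by total functions whose values on a
  nowhere dense closed subset are irrelevant; for this reason, orders at \<open>P\<close> are expressed by
  equations that hold on a punctured neighbourhood of \<open>P\<close>.
\<close>

definition almost_everywhere ::
    "('n, 'k::field) point set \<Rightarrow> (('n, 'k) point \<Rightarrow> bool) \<Rightarrow> bool" where
  "almost_everywhere X \<Phi> \<longleftrightarrow>
     (\<exists>U. openin (zar X) U \<and> zar X closure_of U = X \<and> (\<forall>Q\<in>U. \<Phi> Q))"

definition meromorphic :: "('n, 'k::field) point set \<Rightarrow> (('n, 'k) point \<Rightarrow> 'k) \<Rightarrow> bool" where
  "meromorphic X f \<longleftrightarrow> almost_everywhere X (\<lambda>Q. regular_at X Q f)"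

definition order_at_least ::
    "('n, 'k::field) point set \<Rightarrow> ('n, 'k) point \<Rightarrow> (('n, 'k) point \<Rightarrow> 'k) \<Rightarrow> int \<Rightarrow> bool" where
  "order_at_least X P f n \<longleftrightarrow> (\<exists>t h. local_parameter X P t \<and> regular_at X P h \<and>
     eventually (\<lambda>Q. f Q = h Q * t Q powi n) (atin (zar X) P))"

definition has_order ::
    "('n, 'k::field) point set \<Rightarrow> ('n, 'k) point \<Rightarrow> (('n, 'k) point \<Rightarrow> 'k) \<Rightarrow> int \<Rightarrow> bool" where
  "has_order X P f n \<longleftrightarrow> (\<exists>t u. local_parameter X P t \<and> regular_at X P u \<and> u P \<noteq> 0 \<and>
     eventually (\<lambda>Q. f Q = u Q * t Q powi n) (atin (zar X) P))"

definition pole_number :: "('n, 'k::field) point set \<Rightarrow> ('n, 'k) point \<Rightarrow> nat \<Rightarrow> bool" where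
  "pole_number X P m \<longleftrightarrow> (\<exists>f. meromorphic X f \<and> has_order X P f (- int m) \<and>
     (\<forall>Q\<in>X - {P}. order_at_least X Q f 0))"

definition divisor :: "('n, 'k::field) point set \<Rightarrow> (('n, 'k) point \<Rightarrow> int) \<Rightarrow> bool" where
  "divisor X D \<longleftrightarrow> finite {P. D P \<noteq> 0} \<and> {P. D P \<noteq> 0} \<subseteq> X"

definition divisor_degree :: "(('n, 'k::field) point \<Rightarrow> int) \<Rightarrow> int" where
  "divisor_degree D = (\<Sum>P | D P \<noteq> 0. D P)"

definition riemann_roch_space ::
    "('n, 'k::field) point set \<Rightarrow> (('n, 'k) point \<Rightarrow> int) \<Rightarrow> (('n, 'k) point \<Rightarrow> 'k) set" where
  "riemann_roch_space X D = {f. meromorphic X f \<and> (\<forall>P\<in>X. order_at_least X P f (- D P))}"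

text \<open>Linear independence over \<open>'k\<close> as elements of the field of meromorphic functions.\<close>

definition independent_meromorphic ::
    "('n, 'k::field) point set \<Rightarrow> (('n, 'k) point \<Rightarrow> 'k) set \<Rightarrow> bool" where
  "independent_meromorphic X B \<longleftrightarrow> finite B \<and>
     (\<forall>c. almost_everywhere X (\<lambda>Q. (\<Sum>f\<in>B. c f * f Q) = 0) \<longrightarrow> (\<forall>f\<in>B. c f = 0))"

definition riemann_roch_dim ::
    "('n, 'k::field) point set \<Rightarrow> (('n, 'k) point \<Rightarrow> int) \<Rightarrow> nat" where
  "riemann_roch_dim X D =
     Max {card B |B. B \<subseteq> riemann_roch_space X D \<and> independent_meromorphic X B}"

text \<open>Riemann's definition: the genus is the maximum of \<open>deg D - l(D) + 1\<close> over all divisors \<open>D\<close>.\<close>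

definition has_genus :: "('n, 'k::field) point set \<Rightarrow> nat \<Rightarrow> bool" where
  "has_genus X g \<longleftrightarrow>
     (\<exists>D. divisor X D \<and> int g = divisor_degree D - int (riemann_roch_dim X D) + 1) \<and>
     (\<forall>D. divisor X D \<longrightarrow> divisor_degree D - int (riemann_roch_dim X D) + 1 \<le> int g)"


section \<open>Automorphisms and ramification groups\<close>

definition morphism ::
    "('n, 'k::field) point set \<Rightarrow> ('n, 'k) point set \<Rightarrow> (('n, 'k) point \<Rightarrow> ('n, 'k) point) \<Rightarrow> bool"
  where
  "morphism X Y \<phi> \<longleftrightarrow> continuous_map (zar X) (zar Y) \<phi> \<and>
     (\<forall>V h. openin (zar Y) V \<longrightarrow> (\<forall>Q\<in>V. regular_at Y Q h) \<longrightarrow>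
        (\<forall>P\<in>X. \<phi> P \<in> V \<longrightarrow> regular_at X P (h \<circ> \<phi>)))"

definition aut_group ::
    "('n, 'k::field) point set \<Rightarrow> (('n, 'k) point \<Rightarrow> ('n, 'k) point) monoid" where
  "aut_group X = (BijGroup X)\<lparr>carrier :=
     {\<phi> \<in> Bij X. morphism X X \<phi> \<and> morphism X X (restrict (inv_into X \<phi>) X)}\<rparr>"

definition decomposition_group ::
    "(('n, 'k::field) point \<Rightarrow> ('n, 'k) point) set \<Rightarrow> ('n, 'k) point \<Rightarrow>
     (('n, 'k) point \<Rightarrow> ('n, 'k) point) set" where
  "decomposition_group G P = {g \<in> G. g P = P}"

text \<open>
  An automorphism \<open>g\<close> acts on functions from the left by composition with its inverse. The
  condition below does not depend on the choice of the local parameter \<open>t\<close>.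
\<close>

definition ramification_group ::
    "('n, 'k::field) point set \<Rightarrow> (('n, 'k) point \<Rightarrow> ('n, 'k) point) set \<Rightarrow> ('n, 'k) point \<Rightarrow> nat \<Rightarrow>
     (('n, 'k) point \<Rightarrow> ('n, 'k) point) set" where
  "ramification_group X G P i = {g \<in> decomposition_group G P. \<exists>t. local_parameter X P t \<and>
     (\<lambda>Q. t (inv_into X g Q) - t Q) \<in> local_ideal X P (\<lambda>Q. t Q ^ (i + 1))}"

definition ramified_at ::
    "('n, 'k::field) point set \<Rightarrow> (('n, 'k) point \<Rightarrow> ('n, 'k) point) set \<Rightarrow> ('n, 'k) point \<Rightarrow> bool"
  where
  "ramified_at X G P \<longleftrightarrow> decomposition_group G P \<noteq> {\<one>\<^bsub>aut_group X\<^esub>}"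

definition weakly_ramified ::
    "('n, 'k::field) point set \<Rightarrow> (('n, 'k) point \<Rightarrow> ('n, 'k) point) set \<Rightarrow> bool" where
  "weakly_ramified X G \<longleftrightarrow>
     (\<forall>P\<in>X. \<forall>i\<ge>2. ramification_group X G P i = {\<one>\<^bsub>aut_group X\<^esub>})"

end

theory Submission
  imports Defs "HOL-Algebra.Multiplicative_Group"
begin

text \<open>
  Let \<open>t\<close> be a local parameter at \<open>P\<close>, \<open>z = 1/t\<close>, and let \<open>D\<close> be the decomposition group of \<open>P\<close>. It is a
  2-group, so its elements \<open>s\<close> act trivially on the cotangent line at \<open>P\<close> (\<open>tangent_1\<close>), and
  therefore \<open>z \<circ> s = z + a + O(t)\<close> for a constant \<open>a = a(s)\<close>. The map \<open>a\<close> is additive, and injective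
  since the second ramification group is trivial (\<open>shift_compose\<close>, \<open>shift_0\<close>). So every element of
  \<open>D\<close> is an involution, and as \<open>D\<close> is not cyclic there are \<open>s\<close> and \<open>s'\<close> in \<open>D\<close> for which \<open>a = a(s)\<close> and
  \<open>a' = a(s')\<close> are distinct and nonzero (\<open>ex_two_shifts\<close>).

  Odd pole numbers exist because the genus bounds the number of gaps (\<open>ex_odd_pole_number\<close>). Let \<open>m\<close>
  be the smallest one and \<open>f\<close> a function with this pole order, with leading coefficient \<open>c\<close>. As \<open>m\<close> is
  odd, \<open>w = f \<circ> s - f\<close> has a pole of order exactly \<open>m - 1\<close> with leading coefficient \<open>c a\<close>
  (\<open>first_difference\<close>), and it has no other poles since \<open>s\<close> fixes \<open>P\<close>. Hence \<open>m - 1\<close> is a pole number.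

  Suppose that \<open>m - 1\<close> is congruent to 2 modulo 4. From \<open>s \<circ> s = id\<close> and characteristic 2 one gets
  \<open>w \<circ> s = w\<close>. On a function of pole order twice an odd number, with coefficients \<open>d\<^sub>0\<close> and \<open>d\<^sub>1\<close> in the
  highest two degrees, this invariance forces \<open>d\<^sub>0 a\<^sup>2 + d\<^sub>1 a = 0\<close> (\<open>second_difference\<close>), whence
  \<open>d\<^sub>1 = c a\<^sup>2\<close> for \<open>w\<close> (\<open>second_coefficient\<close>). The same holds for \<open>w' = f \<circ> s' - f\<close> and \<open>a'\<close>. In
  \<open>w - (a / a') w'\<close> the leading terms cancel, while the coefficient in degree \<open>m - 2\<close> is
  \<open>c a (a - a') \<noteq> 0\<close>. So \<open>m - 2\<close> is an odd pole number, contrary to the choice of \<open>m\<close>.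

  These arguments only use truncated expansions at \<open>P\<close>. They rest on two facts about the local ring at
  a point of a smooth connected curve: no point is isolated (\<open>nonisolated\<close>), and a local parameter
  has no further zeros nearby (\<open>t_nonzero\<close>).
\<close>

section \<open>Local rings of projective sets\<close>

lemma point_of_eqI:
  assumes "Q \<in> proj_space" "x \<in> Q"
  shows "Q = point_of x"
proof -
  from assms obtain z c where Q: "Q = point_of z" and c: "c \<noteq> 0" "x = (\<lambda>i. c * z i)"
    by (auto simp: proj_space_def point_of_def)
  show ?thesis
  proof (intro equalityI subsetI)
    fix y assume "y \<in> Q"
    then obtain d where d: "d \<noteq> 0" "y = (\<lambda>i. d * z i)"
      by (auto simp: Q point_of_def)
    then have "d / c \<noteq> 0" "y = (\<lambda>i. (d / c) * x i)"
      using c by auto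
    then show "y \<in> point_of x"
      unfolding point_of_def by blast
  next
    fix y assume "y \<in> point_of x"
    then obtain d where d: "d \<noteq> 0" "y = (\<lambda>i. d * x i)"
      by (auto simp: point_of_def)
    then have "d * c \<noteq> 0" "y = (\<lambda>i. (d * c) * z i)"
      using c by (auto simp: mult.assoc)
    then show "y \<in> Q"
      unfolding Q point_of_def by blast
  qed
qed

lemma homogeneous_linear2: "homogeneous 1 (\<lambda>x. x i * a + x j * b)"
  using homogeneous.add[OF homogeneous.coord[OF homogeneous.const] homogeneous.coord[OF homogeneous.const]]
  by simp

lemma openin_nonvanishing:
  assumes "homogeneous d F"
  shows "openin zariski {Q \<in> proj_space. \<forall>x\<in>Q. F x \<noteq> 0}"
  unfolding openin_zariski
proof
  have "proj_space - {Q \<in> proj_space. \<forall>x\<in>Q. F x \<noteq> 0} = zero_locus {F}"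
    using homogeneous_zero_on_point[OF assms] by (fastforce simp: zero_locus_def dest: point_nonempty)
  then show "algebraic_set (proj_space - {Q \<in> proj_space. \<forall>x\<in>Q. F x \<noteq> 0})"
    using assms unfolding algebraic_set_def by blast
qed blast

lemma closedin_point:
  assumes "P \<in> proj_space"
  shows "closedin zariski {P}"
proof -
  from assms obtain p where P: "P = point_of p" and "\<exists>i. p i \<noteq> 0"
    by (auto simp: proj_space_def)
  then obtain j where j: "p j \<noteq> 0" by blast
  define S where "S = (\<lambda>i x. x i * p j + x j * (- p i)) ` UNIV"
  have "zero_locus S = {P}"
  proof (intro equalityI subsetI)
    fix Q assume Q: "Q \<in> zero_locus S"
    then have Qp: "Q \<in> proj_space" by (simp add: zero_locus_def)
    then obtain x where x: "x \<in> Q" using point_nonempty by blast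
    have eq: "x i * p j = x j * p i" for i
      using Q x by (auto simp: zero_locus_def S_def)
    have "p \<in> point_of x"
    proof -
      have "x j \<noteq> 0"
      proof
        assume "x j = 0"
        with eq j have "x i = 0" for i by (metis mult_eq_0_iff)
        moreover from Qp x have "\<exists>i. x i \<noteq> 0"
          by (auto simp: proj_space_def point_of_def)
        ultimately show False by blast
      qed
      with eq j have "p = (\<lambda>i. (p j / x j) * x i)" "p j / x j \<noteq> 0"
        by (auto simp: fun_eq_iff field_simps)
      then show ?thesis unfolding point_of_def by blast
    qed
    then have "p \<in> Q" using point_of_eqI[OF Qp x] by simp
    then show "Q \<in> {P}" using point_of_eqI[OF Qp] P by simp
  next
    fix Q assume "Q \<in> {P}"
    with assms P show "Q \<in> zero_locus S"
      by (auto simp: zero_locus_def S_def point_of_def)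
  qed
  moreover have "\<exists>d. homogeneous d F" if "F \<in> S" for F
    using that homogeneous_linear2[of _ "p j" j "- p _"] unfolding S_def by blast
  ultimately have "algebraic_set {P}"
    unfolding algebraic_set_def by metis
  moreover have "proj_space - (proj_space - {P}) = {P}" using assms by blast
  ultimately show ?thesis
    using assms by (simp add: closedin_def topspace_zariski openin_zariski)
qed

lemma eventually_nhdsin_atin:
  "eventually \<Phi> (nhdsin T a) \<longleftrightarrow> eventually \<Phi> (atin T a) \<and> (a \<in> topspace T \<longrightarrow> \<Phi> a)"
  by (auto simp: eventually_nhdsin eventually_atin) 

text \<open>
  Since points are closed, a property that holds on a punctured neighbourhood of a point holds on
  whole neighbourhoods of all other points nearby. This turns equations of germs at one point into
  equations of germs at the neighbouring points.
\<close>

lemma eventually_atin_nhdsin: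
  assumes "closedin T {a}" "eventually \<Phi> (atin T a)"
  shows "\<forall>\<^sub>F b in atin T a. eventually \<Phi> (nhdsin T b)"
proof -
  have "a \<in> topspace T"
    using assms(1) closedin_subset by fastforce
  with assms(2) obtain U where U: "openin T U" "a \<in> U" "\<forall>x\<in>U - {a}. \<Phi> x"
    by (auto simp: eventually_atin)
  with assms(1) have "openin T (U - {a})"
    by blast
  then have "eventually \<Phi> (nhdsin T b)" if "b \<in> U - {a}" for b
    using that U(3) unfolding eventually_nhdsin by blast
  with U show ?thesis
    unfolding eventually_atin by blast
qed

text \<open>
  Everything below is done with representatives of germs. Membership in the local ring depends
  only on the germ, so the usual ring operations can be checked on quotients of homogeneous
  functions near the point.
\<close>

lemma regular_at_cong:
  assumes "regular_at X P f" "\<forall>\<^sub>F Q in nhdsin (zar X) P. g Q = f Q"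
  shows "regular_at X P g"
proof -
  from assms(1) obtain d F H where *: "homogeneous d F" "homogeneous d H"
    "\<forall>\<^sub>F Q in nhdsin (zar X) P. \<forall>x\<in>Q. H x \<noteq> 0 \<and> f Q = F x / H x"
    unfolding regular_at_def by blast
  from *(3) assms(2) have "\<forall>\<^sub>F Q in nhdsin (zar X) P. \<forall>x\<in>Q. H x \<noteq> 0 \<and> g Q = F x / H x"
    by eventually_elim simp
  with * show ?thesis unfolding regular_at_def by blast
qed

lemma regular_at_const: "regular_at X P (\<lambda>_. c)"
  unfolding regular_at_def
  by (intro exI[of _ 0] exI[of _ "\<lambda>_. c"] exI[of _ "\<lambda>_. 1"] conjI homogeneous.const) simp

lemma regular_at_add:
  assumes "regular_at X P f" "regular_at X P g"
  shows "regular_at X P (\<lambda>Q. f Q + g Q)"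
proof -
  from assms(1) obtain d F H where F: "homogeneous d F" "homogeneous d H"
    "\<forall>\<^sub>F Q in nhdsin (zar X) P. \<forall>x\<in>Q. H x \<noteq> 0 \<and> f Q = F x / H x"
    unfolding regular_at_def by blast
  from assms(2) obtain e F' H' where F': "homogeneous e F'" "homogeneous e H'"
    "\<forall>\<^sub>F Q in nhdsin (zar X) P. \<forall>x\<in>Q. H' x \<noteq> 0 \<and> g Q = F' x / H' x"
    unfolding regular_at_def by blast
  have "homogeneous (d + e) (\<lambda>x. F x * H' x + H x * F' x)"
    using F F' by (intro homogeneous.add homogeneous_mult)
  moreover have "homogeneous (d + e) (\<lambda>x. H x * H' x)"
    using F F' by (intro homogeneous_mult)
  moreover from F(3) F'(3) have "\<forall>\<^sub>F Q in nhdsin (zar X) P.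
      \<forall>x\<in>Q. H x * H' x \<noteq> 0 \<and> f Q + g Q = (F x * H' x + H x * F' x) / (H x * H' x)"
    by eventually_elim (auto simp: add_frac_eq)
  ultimately show ?thesis unfolding regular_at_def by blast
qed

lemma regular_at_mult:
  assumes "regular_at X P f" "regular_at X P g"
  shows "regular_at X P (\<lambda>Q. f Q * g Q)"
proof -
  from assms(1) obtain d F H where F: "homogeneous d F" "homogeneous d H"
    "\<forall>\<^sub>F Q in nhdsin (zar X) P. \<forall>x\<in>Q. H x \<noteq> 0 \<and> f Q = F x / H x"
    unfolding regular_at_def by blast
  from assms(2) obtain e F' H' where F': "homogeneous e F'" "homogeneous e H'"
    "\<forall>\<^sub>F Q in nhdsin (zar X) P. \<forall>x\<in>Q. H' x \<noteq> 0 \<and> g Q = F' x / H' x"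
    unfolding regular_at_def by blast
  have "homogeneous (d + e) (\<lambda>x. F x * F' x)" "homogeneous (d + e) (\<lambda>x. H x * H' x)"
    using F F' by (auto intro: homogeneous_mult)
  moreover from F(3) F'(3) have "\<forall>\<^sub>F Q in nhdsin (zar X) P.
      \<forall>x\<in>Q. H x * H' x \<noteq> 0 \<and> f Q * g Q = (F x * F' x) / (H x * H' x)"
    by eventually_elim auto
  ultimately show ?thesis unfolding regular_at_def by blast
qed

lemma regular_at_diff:
  assumes "regular_at X P f" "regular_at X P g"
  shows "regular_at X P (\<lambda>Q. f Q - g Q)"
  using regular_at_add[OF assms(1) regular_at_mult[OF regular_at_const[of _ _ "-1"] assms(2)]]
  by simp

lemma regular_at_power: "regular_at X P f \<Longrightarrow> regular_at X P (\<lambda>Q. f Q ^ n)"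
  by (induction n) (auto intro: regular_at_const regular_at_mult)

lemma regular_at_inverse:
  assumes "regular_at X P f" "f P \<noteq> 0" "P \<in> X" "X \<subseteq> proj_space"
  shows "regular_at X P (\<lambda>Q. inverse (f Q))" "\<forall>\<^sub>F Q in nhdsin (zar X) P. f Q \<noteq> 0"
proof -
  have Ptop: "P \<in> topspace (zar X)" using assms by (auto simp: topspace_zariski)
  from assms(1) obtain d F H where *: "homogeneous d F" "homogeneous d H"
    "\<forall>\<^sub>F Q in nhdsin (zar X) P. \<forall>x\<in>Q. H x \<noteq> 0 \<and> f Q = F x / H x"
    unfolding regular_at_def by blast
  have P: "\<forall>x\<in>P. H x \<noteq> 0 \<and> f P = F x / H x"
    using *(3) Ptop unfolding eventually_nhdsin_atin by simp
  define U where "U = X \<inter> {Q \<in> proj_space. \<forall>x\<in>Q. F x \<noteq> 0}"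
  have "openin (zar X) U" "P \<in> U"
    unfolding U_def using openin_nonvanishing[OF *(1)] assms P
    by (auto simp: openin_subtopology_Int2)
  then have "\<forall>\<^sub>F Q in nhdsin (zar X) P. \<forall>x\<in>Q. F x \<noteq> 0"
    unfolding eventually_nhdsin by (auto simp: U_def intro!: exI[of _ U])
  with *(3) have "\<forall>\<^sub>F Q in nhdsin (zar X) P. \<forall>x\<in>Q. F x \<noteq> 0 \<and> inverse (f Q) = H x / F x"
    by eventually_elim auto
  with * show "regular_at X P (\<lambda>Q. inverse (f Q))" unfolding regular_at_def by blast
  have "\<forall>\<^sub>F Q in nhdsin (zar X) P. Q \<in> X"
    unfolding eventually_nhdsin using assms Ptop
    by (intro disjI2 exI[of _ "topspace (zar X)"] conjI openin_topspace) auto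
  with \<open>\<forall>\<^sub>F Q in nhdsin (zar X) P. \<forall>x\<in>Q. F x \<noteq> 0\<close> *(3)
  show "\<forall>\<^sub>F Q in nhdsin (zar X) P. f Q \<noteq> 0"
  proof eventually_elim
    case (elim Q)
    then obtain x where "x \<in> Q" using assms(4) point_nonempty by blast
    with elim show ?case by auto
  qed
qed

lemma regular_at_power_int:
  assumes "regular_at X P f" "f P \<noteq> 0" "P \<in> X" "X \<subseteq> proj_space"
  shows "regular_at X P (\<lambda>Q. f Q powi n)"
  unfolding power_int_def
  using regular_at_power[OF assms(1)] regular_at_power[OF regular_at_inverse(1)[OF assms]]
  by (cases "n \<ge> 0") auto

lemma regular_at_open:
  assumes "regular_at X P f" "P \<in> topspace (zar X)"
  shows "\<exists>U. openin (zar X) U \<and> P \<in> U \<and> (\<forall>Q\<in>U. regular_at X Q f)"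
proof -
  from assms obtain d F H U where *: "homogeneous d F" "homogeneous d H"
    "openin (zar X) U" "P \<in> U" "\<forall>Q\<in>U. \<forall>x\<in>Q. H x \<noteq> 0 \<and> f Q = F x / H x"
    unfolding regular_at_def eventually_nhdsin by auto
  have "regular_at X Q f" if "Q \<in> U" for Q
    unfolding regular_at_def
  proof (intro exI conjI)
    show "\<forall>\<^sub>F Q in nhdsin (zar X) Q. \<forall>x\<in>Q. H x \<noteq> 0 \<and> f Q = F x / H x"
      unfolding eventually_nhdsin using *(3,5) that by auto
  qed (use * in auto)
  with * show ?thesis by blast
qed

lemma regular_at_eventually:
  assumes "regular_at X P f"
  shows "\<forall>\<^sub>F Q in nhdsin (zar X) P. regular_at X Q f"
  using regular_at_open[OF assms] unfolding eventually_nhdsin by blast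

section \<open>Points of a smooth curve\<close>

locale smooth_curve =
  fixes X :: "('n::finite, 'k::alg_closed_field) point set"
  assumes smooth: "smooth_projective_curve X"
begin

lemma sub_proj: "X \<subseteq> proj_space"
  using smooth closedin_subset by (fastforce simp: smooth_projective_curve_def topspace_zariski)

lemma topspace_zar [simp]: "topspace (zar X) = X"
  using sub_proj by (auto simp: topspace_zariski)

lemma in_topspace_zariski [simp]: "Q \<in> X \<Longrightarrow> Q \<in> topspace zariski"
  using sub_proj by (auto simp: topspace_zariski)

lemma closedin_zar_point: "P \<in> X \<Longrightarrow> closedin (zar X) {P}"
  using closedin_point[of P] sub_proj by (auto simp: closedin_subtopology)

text \<open>
  An isolated point would be open and closed, hence the whole connected curve, which would then
  have dimension 0. Consequently germs are determined by their values on punctured neighbourhoods,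
  and this is what makes leading coefficients unique.
\<close>

lemma nonisolated:
  assumes "P \<in> X"
  shows "atin (zar X) P \<noteq> bot"
proof
  assume "atin (zar X) P = bot"
  then have ev: "eventually (\<lambda>_. False) (atin (zar X) P)" by simp
  have op: "openin (zar X) {P}"
  proof -
    from ev assms obtain U where U: "openin (zar X) U" "P \<in> U" "U - {P} \<subseteq> {}"
      by (auto simp: eventually_atin)
    then have "U = {P}" by blast
    with U(1) show ?thesis by simp
  qed
  have "connected_space (zar X)"
    using smooth by (simp add: smooth_projective_curve_def connectedin_def)
  with op closedin_zar_point[OF assms] have XP: "X = {P}"
    unfolding connected_space_clopen_in by (metis insert_not_empty topspace_zar)
  from smooth have "has_chain X 1"
    by (simp add: smooth_projective_curve_def has_dimension_def)
  then obtain Z where Z: "\<And>i. i \<le> 1 \<Longrightarrow> closedin (zar X) (Z i) \<and> irreducible_set (Z i)"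
     "Z 0 \<subset> Z (Suc 0)"
    unfolding has_chain_def by auto
  have "Z 0 \<noteq> {}" "Z (Suc 0) \<subseteq> X"
    using Z(1)[of 0] Z(1)[of 1] closedin_subset[of "zar X" "Z 1"] by (auto simp: irreducible_set_def)
  with Z(2) XP show False by auto
qed

lemma regular_at_zero:
  assumes "P \<in> X" "regular_at X P f" "\<forall>\<^sub>F Q in atin (zar X) P. f Q = 0"
  shows "f P = 0"
proof (rule ccontr)
  assume "f P \<noteq> 0"
  with regular_at_inverse(2)[OF assms(2) _ assms(1) sub_proj]
  have "\<forall>\<^sub>F Q in atin (zar X) P. f Q \<noteq> 0"
    by (simp add: eventually_nhdsin_atin)
  with assms(3) have "\<forall>\<^sub>F Q in atin (zar X) P. False"
    by eventually_elim simp
  with nonisolated[OF assms(1)] show False by simp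
qed

lemma ex_local_parameter: "P \<in> X \<Longrightarrow> \<exists>t. local_parameter X P t"
  using smooth by (auto simp: smooth_projective_curve_def)

end

locale curve_point = smooth_curve +
  fixes P t
  assumes P: "P \<in> X" and t: "local_parameter X P t"
begin

abbreviation near :: "(('a, 'b) point \<Rightarrow> bool) \<Rightarrow> bool" where
  "near \<Phi> \<equiv> eventually \<Phi> (atin (zar X) P)"

lemma regular_t: "regular_at X P t"
  using t by (simp add: local_parameter_def)

lemma factor_t:
  assumes "regular_at X P f" "f P = 0"
  obtains h where "regular_at X P h" "\<forall>\<^sub>F Q in nhdsin (zar X) P. f Q = t Q * h Q"
proof -
  from assms have "f \<in> local_ideal X P t"
    using t by (simp add: local_parameter_def maximal_ideal_at_def)
  with that show ?thesis by (auto simp: local_ideal_def)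
qed

lemma t_P: "t P = 0"
proof -
  have "t \<in> local_ideal X P t"
    unfolding local_ideal_def using regular_t regular_at_const[of X P 1] by force
  then show ?thesis
    using t by (simp add: local_parameter_def maximal_ideal_at_def)
qed

text \<open>
  If \<open>p\<close> represents \<open>P\<close> and \<open>p j \<noteq> 0\<close>, the affine coordinates \<open>x i / x j - p i / p j\<close> vanish at \<open>P\<close>,
  hence are multiples of \<open>t\<close> near \<open>P\<close>. There are finitely many of them, so on a common
  neighbourhood every zero of \<open>t\<close> has the same coordinates as \<open>P\<close>.
\<close>

lemma t_nonzero: "near (\<lambda>Q. t Q \<noteq> 0)"
proof -
  obtain p where P_eq: "P = point_of p" and "\<exists>i. p i \<noteq> 0"
    using P sub_proj unfolding proj_space_def by blast
  then obtain j where j: "p j \<noteq> 0" by blast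
  define F where "F i x = x i * p j + x j * (- p i)" for i and x :: "'a \<Rightarrow> 'b"
  define H where "H x = x j * p j + x j * 0" for x :: "'a \<Rightarrow> 'b"
  define y where "y i Q = (let x = (SOME x. x \<in> Q) in F i x / H x)" for i and Q :: "('a, 'b) point"
  have F: "homogeneous 1 (F i)" for i
    unfolding F_def by (rule homogeneous_linear2)
  have H: "homogeneous 1 H"
    unfolding H_def by (rule homogeneous_linear2)
  define U where "U = X \<inter> {Q \<in> proj_space. \<forall>x\<in>Q. H x \<noteq> 0}"
  have U: "openin (zar X) U" "P \<in> U"
    unfolding U_def using openin_nonvanishing[OF H] P sub_proj j
    by (auto simp: openin_subtopology_Int2 P_eq point_of_def H_def)
  have yU: "F i x / H x = y i Q" if "Q \<in> U" "x \<in> Q" for i Q x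
  proof -
    have x: "(SOME x. x \<in> Q) \<in> Q" using someI[of "\<lambda>x. x \<in> Q" x] that(2) by simp
    have "Q = point_of x" using point_of_eqI that by (auto simp: U_def)
    with x obtain c where c: "c \<noteq> 0" "(SOME x. x \<in> Q) = (\<lambda>i. c * x i)"
      by (auto simp: point_of_def)
    show ?thesis
      unfolding y_def Let_def c(2) homogeneous_scale[OF F] homogeneous_scale[OF H] using c(1) by simp
  qed
  have ev_U: "\<forall>\<^sub>F Q in nhdsin (zar X) P. Q \<in> U"
    using U unfolding eventually_nhdsin by blast
  have "regular_at X P (y i)" for i
    unfolding regular_at_def
  proof (intro exI conjI)
    show "\<forall>\<^sub>F Q in nhdsin (zar X) P. \<forall>x\<in>Q. H x \<noteq> 0 \<and> y i Q = F i x / H x"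
      using ev_U by eventually_elim (auto simp: yU, auto simp: U_def)
  qed (use F H in auto)
  moreover have "y i P = 0" for i
  proof -
    have "p \<in> P" unfolding P_eq point_of_def by (auto intro!: exI[of _ 1])
    with yU[OF U(2), of p i] show ?thesis by (simp add: F_def)
  qed
  ultimately have "\<exists>h. \<forall>\<^sub>F Q in nhdsin (zar X) P. y i Q = t Q * h Q" for i
    by (metis factor_t)
  then obtain h where "\<And>i. \<forall>\<^sub>F Q in nhdsin (zar X) P. y i Q = t Q * h i Q"
    by metis
  then have "\<forall>\<^sub>F Q in nhdsin (zar X) P. \<forall>i. y i Q = t Q * h i Q"
    by (rule eventually_all_finite)
  with ev_U have "\<forall>\<^sub>F Q in nhdsin (zar X) P. t Q = 0 \<longrightarrow> Q = P"
  proof eventually_elim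
    case (elim Q)
    show ?case
    proof
      assume "t Q = 0"
      with elim(2) have y0: "y i Q = 0" for i by simp
      from elim(1) have Q: "Q \<in> proj_space" by (simp add: U_def)
      then obtain x where x: "x \<in> Q" using point_nonempty by blast
      with elim(1) have Hx: "H x \<noteq> 0" by (auto simp: U_def)
      have "F i x = 0" for i using yU[OF elim(1) x, of i] y0 Hx by simp
      then have "x i = (x j / p j) * p i" for i
        using j by (auto simp: F_def field_simps)
      moreover have "x j / p j \<noteq> 0" using Hx j by (auto simp: H_def)
      ultimately have "x \<in> P" unfolding P_eq point_of_def by blast
      then show "Q = P" using point_of_eqI[OF Q x] point_of_eqI P sub_proj by blast
    qed
  qed
  moreover have "near (\<lambda>Q. Q \<noteq> P)"
    unfolding eventually_atin using P by (metis DiffE insertI1 openin_topspace topspace_zar)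
  ultimately show ?thesis
    unfolding eventually_nhdsin_atin by (auto elim: eventually_elim2)
qed

end

context curve_point
begin

text \<open>
  The fractional ideal \<open>t\<^sup>n O\<close> of the local ring \<open>O\<close> at \<open>P\<close>, that is, the functions that are
  \<open>O(t\<^sup>n)\<close>. Fixing \<open>t\<close> once and for all turns estimates of orders into a calculus of big-O terms;
  on a punctured neighbourhood of \<open>P\<close> the parameter has no zeros, so negative exponents are
  harmless.
\<close>

definition ord_ge :: "int \<Rightarrow> (('a, 'b) point \<Rightarrow> 'b) \<Rightarrow> bool" where
  "ord_ge n f \<longleftrightarrow> (\<exists>h. regular_at X P h \<and> near (\<lambda>Q. f Q = h Q * t Q powi n))"

lemma regular_values_agree: "regular_at X P f \<Longrightarrow> regular_at X P g \<Longrightarrow> near (\<lambda>Q. f Q = g Q) \<Longrightarrow> f P = g P"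
  using regular_at_zero[OF P regular_at_diff[of X P f g]] by simp

lemma ord_ge_cong:
  assumes "ord_ge n f" "near (\<lambda>Q. g Q = f Q)"
  shows "ord_ge n g"
proof -
  from assms(1) obtain h where h: "regular_at X P h" "near (\<lambda>Q. f Q = h Q * t Q powi n)"
    by (auto simp: ord_ge_def)
  from h(2) assms(2) have "near (\<lambda>Q. g Q = h Q * t Q powi n)"
    by eventually_elim simp
  with h(1) show ?thesis unfolding ord_ge_def by blast
qed

lemma ord_ge_add:
  assumes "ord_ge n f" "ord_ge n g"
  shows "ord_ge n (\<lambda>Q. f Q + g Q)"
proof -
  from assms obtain h h' where h: "regular_at X P h" "near (\<lambda>Q. f Q = h Q * t Q powi n)"
    and h': "regular_at X P h'" "near (\<lambda>Q. g Q = h' Q * t Q powi n)"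
    by (auto simp: ord_ge_def)
  from h(2) h'(2) have "near (\<lambda>Q. f Q + g Q = (h Q + h' Q) * t Q powi n)"
    by eventually_elim (simp add: distrib_right)
  then show ?thesis
    unfolding ord_ge_def using regular_at_add[OF h(1) h'(1)] by blast
qed

lemma ord_ge_mult:
  assumes "ord_ge n f" "ord_ge m g"
  shows "ord_ge (n + m) (\<lambda>Q. f Q * g Q)"
proof -
  from assms obtain h h' where h: "regular_at X P h" "near (\<lambda>Q. f Q = h Q * t Q powi n)"
    and h': "regular_at X P h'" "near (\<lambda>Q. g Q = h' Q * t Q powi m)"
    by (auto simp: ord_ge_def)
  from h(2) h'(2) t_nonzero have "near (\<lambda>Q. f Q * g Q = (h Q * h' Q) * t Q powi (n + m))"
    by eventually_elim (simp add: power_int_add)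
  then show ?thesis
    unfolding ord_ge_def using regular_at_mult[OF h(1) h'(1)] by blast
qed

lemma ord_ge_regular: "regular_at X P f \<Longrightarrow> ord_ge 0 f"
  unfolding ord_ge_def by (intro exI[of _ f]) simp

lemma ord_ge_cmult: "ord_ge n f \<Longrightarrow> ord_ge n (\<lambda>Q. c * f Q)"
  using ord_ge_mult[OF ord_ge_regular[OF regular_at_const]] by simp

lemma ord_ge_zero: "ord_ge n (\<lambda>_. 0)"
  unfolding ord_ge_def by (intro exI[of _ "\<lambda>_. 0"]) (simp add: regular_at_const)

lemma ord_ge_t: "ord_ge n (\<lambda>Q. t Q powi n)"
  unfolding ord_ge_def by (intro exI[of _ "\<lambda>_. 1"]) (simp add: regular_at_const)

lemma ord_ge_mono:
  assumes "ord_ge n f" "m \<le> n"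
  shows "ord_ge m f"
proof -
  from assms obtain h where h: "regular_at X P h" "near (\<lambda>Q. f Q = h Q * t Q powi n)"
    by (auto simp: ord_ge_def)
  from h(2) t_nonzero have "near (\<lambda>Q. f Q = (h Q * t Q ^ nat (n - m)) * t Q powi m)"
  proof eventually_elim
    case (elim Q)
    have "t Q powi n = t Q powi (int (nat (n - m)) + m)" using assms(2) by simp
    also have "\<dots> = t Q ^ nat (n - m) * t Q powi m"
      using elim(2) by (subst power_int_add) (simp_all only: power_int_of_nat, simp_all)
    finally show ?case using elim by simp
  qed
  moreover have "regular_at X P (\<lambda>Q. h Q * t Q ^ nat (n - m))"
    using h(1) regular_t by (intro regular_at_mult regular_at_power)
  ultimately show ?thesis unfolding ord_ge_def by blast
qed

lemma regular_vanishing: "regular_at X P f \<Longrightarrow> f P = 0 \<Longrightarrow> ord_ge 1 f"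
  by (erule (1) factor_t) (auto simp: ord_ge_def eventually_nhdsin_atin mult.commute)

text \<open>
  The residue field is the ground field, because \<open>h - h P\<close> lies in the maximal ideal. Iterating this
  produces Laurent expansions of any finite length, without completing the local ring.
\<close>

lemma ord_ge_leading_coeff:
  assumes "regular_at X P h" "near (\<lambda>Q. f Q = h Q * t Q powi n)"
  shows "ord_ge (n + 1) (\<lambda>Q. f Q - h P * t Q powi n)"
proof -
  have "ord_ge 1 (\<lambda>Q. h Q - h P)"
    using regular_at_diff[OF assms(1) regular_at_const] by (rule regular_vanishing) simp
  from ord_ge_mult[OF ord_ge_t this] show ?thesis
    by (rule ord_ge_cong) (use assms(2) in eventually_elim, simp add: algebra_simps)
qed

lemma ord_ge_expand:
  assumes "ord_ge n f"
  obtains c where "ord_ge (n + 1) (\<lambda>Q. f Q - c * t Q powi n)"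
  using assms ord_ge_leading_coeff unfolding ord_ge_def by blast

lemma leading_coeff_zero:
  assumes "ord_ge (n + 1) (\<lambda>Q. c * t Q powi n)"
  shows "c = 0"
proof -
  from assms obtain h where h: "regular_at X P h"
    "near (\<lambda>Q. c * t Q powi n = h Q * t Q powi (n + 1))"
    by (auto simp: ord_ge_def)
  from h(2) t_nonzero have "near (\<lambda>Q. c = h Q * t Q)"
    by eventually_elim (simp add: power_int_add)
  with regular_values_agree[OF regular_at_const regular_at_mult[OF h(1) regular_t], of c] t_P
  show ?thesis by simp
qed

lemma has_order_leading_coeff:
  assumes "ord_ge (n + 1) (\<lambda>Q. f Q - c * t Q powi n)" "c \<noteq> 0"
  shows "has_order X P f n"
proof -
  from assms obtain h where h: "regular_at X P h"
    "near (\<lambda>Q. f Q - c * t Q powi n = h Q * t Q powi (n + 1))"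
    by (auto simp: ord_ge_def)
  from h(2) t_nonzero have "near (\<lambda>Q. f Q = (c + h Q * t Q) * t Q powi n)"
    by eventually_elim (simp add: power_int_add algebra_simps)
  moreover have "regular_at X P (\<lambda>Q. c + h Q * t Q)"
    by (intro regular_at_add regular_at_mult regular_at_const h(1) regular_t)
  moreover have "c + h P * t P \<noteq> 0" using assms(2) t_P by simp
  ultimately show ?thesis unfolding has_order_def using t by blast
qed

text \<open>
  The binomial formula to first order. It is applied with \<open>A = 1/t\<close>, and with \<open>A = 1/t\<^sup>2\<close> to see the
  second-order behaviour of even powers in characteristic 2.
\<close>

lemma ord_ge_binomial:
  assumes A: "ord_ge (- p) A" and B: "ord_ge q B" and "- p \<le> q"
  shows "ord_ge (2 * q - (int n - 2) * p)
           (\<lambda>Q. (A Q + B Q) ^ n - A Q ^ n - of_nat n * A Q ^ (n - 1) * B Q)"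
proof (induction n)
  case 0
  show ?case using ord_ge_zero by simp
next
  case (Suc n)
  let ?E = "\<lambda>Q. (A Q + B Q) ^ n - A Q ^ n - of_nat n * A Q ^ (n - 1) * B Q"
  have pow: "ord_ge (- int k * p) (\<lambda>Q. A Q ^ k)" for k
  proof (induction k)
    case 0
    show ?case using ord_ge_regular[OF regular_at_const, of 1] by simp
  next
    case (Suc k)
    from ord_ge_mult[OF A Suc] show ?case by (simp add: algebra_simps)
  qed
  have "ord_ge (- p) (\<lambda>Q. A Q + B Q)"
    using ord_ge_add[OF A ord_ge_mono[OF B \<open>- p \<le> q\<close>]] .
  from ord_ge_mult[OF this Suc]
  have "ord_ge (2 * q - (int (Suc n) - 2) * p) (\<lambda>Q. (A Q + B Q) * ?E Q)"
    by (simp add: algebra_simps)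
  moreover have "ord_ge (2 * q - (int (Suc n) - 2) * p)
     (\<lambda>Q. of_nat n * (A Q ^ (n - 1) * (B Q * B Q)))"
  proof (cases "n = 0")
    case True
    then show ?thesis using ord_ge_zero by simp
  next
    case False
    from ord_ge_mult[OF pow[of "n - 1"] ord_ge_mult[OF B B]] False
    show ?thesis by (intro ord_ge_cmult) (simp add: algebra_simps of_nat_diff)
  qed
  ultimately have "ord_ge (2 * q - (int (Suc n) - 2) * p)
     (\<lambda>Q. (A Q + B Q) * ?E Q + of_nat n * (A Q ^ (n - 1) * (B Q * B Q)))"
    by (rule ord_ge_add)
  moreover have "(A Q + B Q) * ?E Q + of_nat n * (A Q ^ (n - 1) * (B Q * B Q))
      = (A Q + B Q) ^ Suc n - A Q ^ Suc n - of_nat (Suc n) * A Q ^ (Suc n - 1) * B Q" for Q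
    by (cases n) (simp_all add: algebra_simps)
  ultimately show ?case by simp
qed

text \<open>
  Another parameter is \<open>t' = t u\<close>, where \<open>u\<close> is a unit because \<open>t = t' v\<close> as well; so the choice of
  the parameter does not affect the order.
\<close>

lemma order_at_least_iff: "order_at_least X P f n \<longleftrightarrow> ord_ge n f"
proof
  assume "ord_ge n f"
  then show "order_at_least X P f n"
    unfolding ord_ge_def order_at_least_def using t by blast
next
  assume "order_at_least X P f n"
  then obtain t' h where t': "local_parameter X P t'" and h: "regular_at X P h"
    "near (\<lambda>Q. f Q = h Q * t' Q powi n)"
    unfolding order_at_least_def by blast
  interpret other: curve_point X P t' by unfold_locales (fact P t')+
  obtain u where u: "regular_at X P u" "\<forall>\<^sub>F Q in nhdsin (zar X) P. t' Q = t Q * u Q"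
    using factor_t other.regular_t other.t_P by blast
  obtain v where v: "regular_at X P v" "\<forall>\<^sub>F Q in nhdsin (zar X) P. t Q = t' Q * v Q"
    using other.factor_t regular_t t_P by blast
  have u_ev: "near (\<lambda>Q. t' Q = t Q * u Q)" and v_ev: "near (\<lambda>Q. t Q = t' Q * v Q)"
    using u(2) v(2) by (simp_all add: eventually_nhdsin_atin)
  from u_ev v_ev t_nonzero have "near (\<lambda>Q. u Q * v Q = 1)"
    by eventually_elim (metis mult.assoc mult_cancel_left2)
  from regular_values_agree[OF regular_at_mult[OF u(1) v(1)] regular_at_const this]
  have "u P \<noteq> 0" by auto
  then have "regular_at X P (\<lambda>Q. h Q * u Q powi n)"
    by (intro regular_at_mult h(1) regular_at_power_int u(1) P sub_proj)
  moreover from h(2) u_ev have "near (\<lambda>Q. f Q = (h Q * u Q powi n) * t Q powi n)"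
    by eventually_elim (simp add: power_int_mult_distrib)
  ultimately show "ord_ge n f" unfolding ord_ge_def by blast
qed

lemma order_at_least_0_iff:
  "order_at_least X P f 0 \<longleftrightarrow> (\<exists>h. regular_at X P h \<and> near (\<lambda>Q. f Q = h Q))"
  unfolding order_at_least_iff ord_ge_def by simp

lemma ord_ge_near_regular:
  assumes "ord_ge n f"
  shows "near (\<lambda>Q. regular_at X Q f)"
proof -
  from assms obtain h where h: "regular_at X P h" "near (\<lambda>Q. f Q = h Q * t Q powi n)"
    by (auto simp: ord_ge_def)
  have "near (\<lambda>Q. regular_at X Q h)" "near (\<lambda>Q. regular_at X Q t)"
    using regular_at_eventually[OF h(1)] regular_at_eventually[OF regular_t]
    by (simp_all add: eventually_nhdsin_atin)
  moreover have "near (\<lambda>Q. Q \<in> X)"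
    unfolding eventually_atin using P by (auto intro!: exI[of _ "topspace (zar X)"])
  moreover note eventually_atin_nhdsin[OF closedin_zar_point[OF P] h(2)] t_nonzero
  ultimately show ?thesis
  proof eventually_elim
    case (elim Q)
    have "regular_at X Q (\<lambda>Q. h Q * t Q powi n)"
      by (intro regular_at_mult regular_at_power_int sub_proj elim)
    then show ?case using elim(4) by (rule regular_at_cong)
  qed
qed

end

section \<open>Spaces of functions with poles only at one point\<close>

context smooth_curve
begin

lemma curve_pointI: "local_parameter X P t \<Longrightarrow> P \<in> X \<Longrightarrow> curve_point X P t"
  by unfold_locales

text \<open>
  A function that has an order bound at \<open>Q\<close> is regular at all points of a punctured neighbourhood of
  \<open>Q\<close>. If this happens at every point, the points of regularity form an open set that is dense
  because no point is isolated. Hence closure properties of spaces of meromorphic functions only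
  have to be checked for orders.
\<close>

lemma meromorphic_if_orders:
  assumes "\<And>Q. Q \<in> X \<Longrightarrow> \<exists>n. order_at_least X Q f n"
  shows "meromorphic X f"
  unfolding meromorphic_def almost_everywhere_def
proof (intro exI conjI ballI)
  let ?U = "{Q \<in> X. regular_at X Q f}"
  show "openin (zar X) ?U"
  proof (subst openin_subopen, intro ballI)
    fix Q assume "Q \<in> ?U"
    with regular_at_open[of X Q f] obtain S where S: "openin (zar X) S" "Q \<in> S" "\<forall>R\<in>S. regular_at X R f"
      by auto
    moreover have "S \<subseteq> X" using openin_subset[OF S(1)] by simp
    ultimately show "\<exists>T. openin (zar X) T \<and> Q \<in> T \<and> T \<subseteq> ?U" by blast
  qed
  have "Q \<in> zar X closure_of ?U" if Q: "Q \<in> X" for Q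
    unfolding in_closure_of
  proof (intro conjI allI impI)
    fix T assume T: "Q \<in> T \<and> openin (zar X) T"
    from Q obtain t where "local_parameter X Q t" using ex_local_parameter by blast
    then interpret Q: curve_point X Q t using Q by (rule curve_pointI)
    have "\<forall>\<^sub>F R in atin (zar X) Q. regular_at X R f"
      using assms[OF Q] Q.order_at_least_iff Q.ord_ge_near_regular by blast
    moreover have "\<forall>\<^sub>F R in atin (zar X) Q. R \<in> T"
      using T unfolding eventually_atin by blast
    ultimately have "\<forall>\<^sub>F R in atin (zar X) Q. regular_at X R f \<and> R \<in> T"
      by (rule eventually_conj)
    then obtain R where "regular_at X R f" "R \<in> T"
      using eventually_happens[OF _ ] nonisolated[OF Q] by blast
    moreover have "T \<subseteq> X" using T openin_subset by fastforce
    ultimately show "\<exists>y. y \<in> ?U \<and> y \<in> T" by blast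
  qed (use Q in simp)
  then show "zar X closure_of ?U = X"
    using closure_of_subset_topspace[of "zar X" ?U] by auto
qed blast

lemma order_at_least_add:
  assumes "Q \<in> X" "order_at_least X Q f n" "order_at_least X Q g n"
  shows "order_at_least X Q (\<lambda>R. f R + c * g R) n"
proof -
  from assms(1) obtain t where "local_parameter X Q t" using ex_local_parameter by blast
  then interpret Q: curve_point X Q t using assms(1) by (rule curve_pointI)
  show ?thesis
    using assms unfolding Q.order_at_least_iff by (intro Q.ord_ge_add Q.ord_ge_cmult)
qed

text \<open>
  The Riemann-Roch space \<open>L(n P)\<close>.
\<close>

definition poles_at :: "('n, 'k) point \<Rightarrow> nat \<Rightarrow> (('n, 'k) point \<Rightarrow> 'k) set" where
  "poles_at P n = {f. order_at_least X P f (- int n) \<and> (\<forall>Q\<in>X - {P}. order_at_least X Q f 0)}"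

lemma poles_at_add:
  "P \<in> X \<Longrightarrow> f \<in> poles_at P n \<Longrightarrow> g \<in> poles_at P n \<Longrightarrow> (\<lambda>R. f R + c * g R) \<in> poles_at P n"
  by (auto simp: poles_at_def order_at_least_add)

lemma poles_at_meromorphic: "f \<in> poles_at P n \<Longrightarrow> meromorphic X f"
  by (rule meromorphic_if_orders) (auto simp: poles_at_def)

lemma riemann_roch_space_point:
  assumes "P \<in> X"
  shows "riemann_roch_space X (\<lambda>Q. if Q = P then int n else 0) = poles_at P n"
  using assms poles_at_meromorphic[of _ P n] by (auto simp: riemann_roch_space_def poles_at_def)

lemma pole_numberI: "f \<in> poles_at P m \<Longrightarrow> has_order X P f (- int m) \<Longrightarrow> pole_number X P m"
  unfolding pole_number_def using poles_at_meromorphic by (auto simp: poles_at_def)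

end

section \<open>Existence of odd pole numbers\<close>

context smooth_curve
begin

lemma almost_everywhere_True: "(\<And>Q. Q \<in> X \<Longrightarrow> \<Phi> Q) \<Longrightarrow> almost_everywhere X \<Phi>"
  unfolding almost_everywhere_def
  using openin_topspace[of "zar X"] closure_of_topspace[of "zar X"] unfolding topspace_zar
  by blast

lemma poles_at_pred_if_gap:
  assumes "P \<in> X" "f \<in> poles_at P (Suc n)" "\<not> pole_number X P (Suc n)"
  shows "f \<in> poles_at P n"
proof -
  from assms(1) obtain t where "local_parameter X P t" using ex_local_parameter by blast
  then interpret P: curve_point X P t using assms(1) by (rule curve_pointI)
  from assms(2) have "P.ord_ge (- int (Suc n)) f"
    by (simp add: poles_at_def P.order_at_least_iff)
  then obtain c where c: "P.ord_ge (- int (Suc n) + 1) (\<lambda>Q. f Q - c * t Q powi (- int (Suc n)))"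
    by (rule P.ord_ge_expand)
  have "c = 0"
    using P.has_order_leading_coeff[OF c] pole_numberI[OF assms(2)] assms(3) by blast
  with c have "P.ord_ge (- int n) f" by simp
  with assms(2) show ?thesis by (simp add: poles_at_def P.order_at_least_iff)
qed

text \<open>
  One step of Gaussian elimination: sending \<open>f\<close> to its coefficient of \<open>t\<close> to the power \<open>-(n+1)\<close> is a
  linear form with kernel \<open>L(n P)\<close>. If it does not vanish on all of \<open>B\<close>, a pivot \<open>f0\<close> clears the
  coefficient of the other members.
\<close>

lemma independent_reduce:
  assumes "P \<in> X" "B \<subseteq> poles_at P (Suc n)" "independent_meromorphic X B"
  shows "\<exists>B'. B' \<subseteq> poles_at P n \<and> independent_meromorphic X B' \<and> card B \<le> card B' + 1"
proof -
  from assms(1) obtain t where "local_parameter X P t" using ex_local_parameter by blast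
  then interpret P: curve_point X P t using assms(1) by (rule curve_pointI)
  let ?n = "- int (Suc n)"
  have "\<exists>c. P.ord_ge (?n + 1) (\<lambda>Q. f Q - c * t Q powi ?n)" if "f \<in> B" for f
    using that assms(2) P.ord_ge_expand[of ?n f] unfolding poles_at_def P.order_at_least_iff by blast
  then obtain c where c: "\<And>f. f \<in> B \<Longrightarrow> P.ord_ge (?n + 1) (\<lambda>Q. f Q - c f * t Q powi ?n)"
    by metis
  have fin: "finite B" and
    ind: "\<And>e. almost_everywhere X (\<lambda>Q. (\<Sum>f\<in>B. e f * f Q) = 0) \<Longrightarrow> \<forall>f\<in>B. e f = 0"
    using assms(3) by (auto simp: independent_meromorphic_def)
  show ?thesis
  proof (cases "\<forall>f\<in>B. c f = 0")
    case True
    have "f \<in> poles_at P n" if "f \<in> B" for f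
      using c[OF that] True that assms(2) by (auto simp: poles_at_def P.order_at_least_iff)
    then show ?thesis using assms(3) by (intro exI[of _ B]) auto
  next
    case False
    then obtain f0 where f0: "f0 \<in> B" "c f0 \<noteq> 0" by blast
    define \<alpha> where "\<alpha> f = - (c f / c f0)" for f
    define \<phi> where "\<phi> f = (\<lambda>Q. f Q + \<alpha> f * f0 Q)" for f :: "('n, 'k) point \<Rightarrow> 'k"
    have \<phi>_app: "\<phi> f Q = f Q + \<alpha> f * f0 Q" for f Q by (simp add: \<phi>_def)
    define B' where "B' = \<phi> ` (B - {f0})"
    have inj: "inj_on \<phi> (B - {f0})"
    proof (rule inj_onI, rule ccontr)
      fix f f' assume f: "f \<in> B - {f0}" "f' \<in> B - {f0}" "\<phi> f = \<phi> f'" "f \<noteq> f'"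
      define e where "e h = (if h = f then 1 else 0) - (if h = f' then 1 else 0)
        + (if h = f0 then \<alpha> f - \<alpha> f' else 0)" for h
      have "(\<Sum>h\<in>B. e h * h Q) = \<phi> f Q - \<phi> f' Q" for Q
      proof -
        have "(\<Sum>h\<in>B. e h * h Q) = (\<Sum>h\<in>B. (if h = f then h Q else 0)
            - (if h = f' then h Q else 0) + (if h = f0 then (\<alpha> f - \<alpha> f') * h Q else 0))"
          by (rule sum.cong) (auto simp: e_def algebra_simps)
        also have "\<dots> = f Q - f' Q + (\<alpha> f - \<alpha> f') * f0 Q"
          using f f0 fin by (simp add: sum.distrib sum_subtractf)
        finally show ?thesis by (simp add: \<phi>_def algebra_simps)
      qed
      with f(3) have "\<forall>h\<in>B. e h = 0"
        by (intro ind almost_everywhere_True) simp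
      with f show False by (auto simp: e_def split: if_splits)
    qed
    have "card B \<le> card B' + 1"
      unfolding B'_def card_image[OF inj] using fin f0(1) by simp
    moreover have "independent_meromorphic X B'"
      unfolding independent_meromorphic_def
    proof (intro conjI allI impI)
      show "finite B'" using fin by (simp add: B'_def)
      fix d assume d: "almost_everywhere X (\<lambda>Q. (\<Sum>h\<in>B'. d h * h Q) = 0)"
      define e where "e f = (if f = f0 then (\<Sum>h\<in>B - {f0}. d (\<phi> h) * \<alpha> h) else d (\<phi> f))" for f
      have "(\<Sum>f\<in>B. e f * f Q) = (\<Sum>h\<in>B'. d h * h Q)" for Q
      proof -
        have "(\<Sum>f\<in>B. e f * f Q) = e f0 * f0 Q + (\<Sum>f\<in>B - {f0}. e f * f Q)"
          using fin f0(1) by (rule sum.remove)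
        also have "(\<Sum>f\<in>B - {f0}. e f * f Q) = (\<Sum>f\<in>B - {f0}. d (\<phi> f) * f Q)"
          by (intro sum.cong) (auto simp: e_def)
        also have "e f0 * f0 Q + \<dots> = (\<Sum>f\<in>B - {f0}. d (\<phi> f) * \<phi> f Q)"
          by (simp add: e_def \<phi>_app sum_distrib_right sum.distrib distrib_left mult.assoc add.commute)
        also have "\<dots> = (\<Sum>h\<in>B'. d h * h Q)"
          unfolding B'_def by (subst sum.reindex[OF inj]) simp
        finally show ?thesis .
      qed
      with d ind[of e] have "\<forall>f\<in>B. e f = 0" by simp
      then show "\<forall>h\<in>B'. d h = 0" by (auto simp: B'_def e_def split: if_splits)
    qed
    moreover have "B' \<subseteq> poles_at P n"
    proof
      fix g assume "g \<in> B'"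
      then obtain f where f: "f \<in> B" and g: "g = \<phi> f" by (auto simp: B'_def)
      have "g \<in> poles_at P (Suc n)"
        unfolding g \<phi>_def using f f0(1) assms(2) by (intro poles_at_add assms(1)) auto
      moreover have "P.ord_ge (?n + 1) g"
      proof (rule P.ord_ge_cong[OF P.ord_ge_add[OF c[OF f] P.ord_ge_cmult[OF c[OF f0(1)], of "\<alpha> f"]]])
        show "P.near (\<lambda>Q. g Q = f Q - c f * t Q powi ?n + \<alpha> f * (f0 Q - c f0 * t Q powi ?n))"
          using f0(2) by (simp add: g \<phi>_def \<alpha>_def algebra_simps)
      qed
      ultimately show "g \<in> poles_at P n"
        by (simp add: poles_at_def P.order_at_least_iff)
    qed
    ultimately show ?thesis by blast
  qed
qed

text \<open>
  If all odd numbers are gaps, the dimension can grow in at most one of any two consecutive steps.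
\<close>

lemma card_independent_bound:
  assumes "P \<in> X" "\<And>m. odd m \<Longrightarrow> \<not> pole_number X P m"
    and "\<And>B. B \<subseteq> poles_at P n \<Longrightarrow> independent_meromorphic X B \<Longrightarrow> card B \<le> d"
    and "B \<subseteq> poles_at P (n + 2 * k)" "independent_meromorphic X B"
  shows "card B \<le> d + k"
  using assms(4,5)
proof (induction k arbitrary: B)
  case 0
  then show ?case using assms(3) by simp
next
  case (Suc k)
  let ?m = "n + 2 * k"
  have sub: "B \<subseteq> poles_at P (Suc (Suc ?m))" using Suc.prems(1) by simp
  have "\<exists>B'. B' \<subseteq> poles_at P ?m \<and> independent_meromorphic X B' \<and> card B \<le> card B' + 1"
  proof (cases "odd (Suc (Suc ?m))")
    case True
    with sub assms(2) have "B \<subseteq> poles_at P (Suc ?m)"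
      using poles_at_pred_if_gap[OF assms(1)] by blast
    then show ?thesis using independent_reduce[OF assms(1)] Suc.prems(2) by blast
  next
    case False
    then have "odd (Suc ?m)" by simp
    with assms(2) have "poles_at P (Suc ?m) \<subseteq> poles_at P ?m"
      using poles_at_pred_if_gap[OF assms(1)] by blast
    then show ?thesis using independent_reduce[OF assms(1) sub Suc.prems(2)] by blast
  qed
  then obtain B' where "B' \<subseteq> poles_at P ?m" "independent_meromorphic X B'" "card B \<le> card B' + 1"
    by blast
  with Suc.IH[of B'] show ?case by simp
qed

text \<open>
  With odd numbers missing from the pole numbers, \<open>l(n P)\<close> would grow at most like \<open>n / 2\<close>, and then
  \<open>n - l(n P) + 1\<close> would not be bounded by the genus. The bound by the genus also yields the
  finiteness of \<open>l(n P)\<close> for some \<open>n\<close>: on infinite sets \<^const>\<open>Max\<close> takes a single default value,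
  so if the dimension were infinite for all \<open>n\<close>, the genus bound would fail for large \<open>n\<close>.
\<close>

lemma ex_odd_pole_number:
  assumes "P \<in> X" "has_genus X g"
  shows "\<exists>m. odd m \<and> pole_number X P m"
proof (rule ccontr)
  assume "\<nexists>m. odd m \<and> pole_number X P m"
  then have none: "\<not> pole_number X P m" if "odd m" for m using that by blast
  define S where "S n = {card B |B. B \<subseteq> poles_at P n \<and> independent_meromorphic X B}" for n
  have genus: "int n - int (Max (S n)) + 1 \<le> int g" for n
  proof -
    let ?D = "\<lambda>Q. if Q = P then int n else 0"
    have "divisor X ?D" using assms(1) by (auto simp: divisor_def)
    moreover have "divisor_degree ?D = int n"
      unfolding divisor_degree_def by (cases "n = 0") auto
    moreover have "riemann_roch_dim X ?D = Max (S n)"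
      unfolding riemann_roch_dim_def riemann_roch_space_point[OF assms(1)] S_def ..
    ultimately show ?thesis using assms(2) unfolding has_genus_def by metis
  qed
  have S0: "0 \<in> S n" for n
    unfolding S_def by (intro CollectI exI[of _ "{}"]) (auto simp: independent_meromorphic_def)
  have "\<exists>n. finite (S n)"
  proof (rule ccontr)
    assume "\<nexists>n. finite (S n)"
    then have "Max (S n) = the None" for n by (simp add: Max.infinite)
    \<comment> \<open>Here \<open>the None\<close> is the default value of \<^const>\<open>Max\<close>; a divisor of degree \<open>g + the None\<close> exceeds the bound by 1.\<close>
    with genus[of "g + the None"] show False by simp
  qed
  then obtain n where fin: "finite (S n)" by blast
  define d where "d = Max (S n)"
  have bound: "x \<le> d + k" if "x \<in> S (n + 2 * k)" for x k
  proof -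
    have "card B \<le> d" if "B \<subseteq> poles_at P n" "independent_meromorphic X B" for B
      unfolding d_def using that fin by (intro Max_ge) (auto simp: S_def)
    with that show ?thesis
      using card_independent_bound[OF assms(1) none] unfolding S_def by blast
  qed
  then have "finite (S (n + 2 * k))" for k
    using finite_nat_set_iff_bounded_le by blast
  then have "Max (S (n + 2 * k)) \<le> d + k" for k
    using bound S0[of "n + 2 * k"] by (subst Max_le_iff) auto
  \<comment> \<open>Along \<open>n + 2 k\<close> the degree grows by \<open>2 k\<close>, the dimension by at most \<open>k\<close>.\<close>
  from this[of "d + g"] genus[of "n + 2 * (d + g)"] show False by simp
qed

end

section \<open>Automorphisms and pullback of functions\<close>

lemma aut_group_simps:
  "carrier (aut_group X) = {\<phi> \<in> Bij X. morphism X X \<phi> \<and> morphism X X (restrict (inv_into X \<phi>) X)}"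
  "\<one>\<^bsub>aut_group X\<^esub> = (\<lambda>x\<in>X. x)"
  "g \<in> Bij X \<Longrightarrow> h \<in> Bij X \<Longrightarrow> g \<otimes>\<^bsub>aut_group X\<^esub> h = compose X g h"
  by (simp_all add: aut_group_def BijGroup_def)

lemma BijGroup_mult: "g \<in> Bij X \<Longrightarrow> h \<in> Bij X \<Longrightarrow> g \<otimes>\<^bsub>BijGroup X\<^esub> h = compose X g h"
  by (simp add: BijGroup_def)

lemma BijGroup_one: "\<one>\<^bsub>BijGroup X\<^esub> = (\<lambda>x\<in>X. x)"
  by (simp add: BijGroup_def)

lemma restrict_inv_into_twice:
  assumes "g \<in> Bij X"
  shows "restrict (inv_into X (restrict (inv_into X g) X)) X = g"
proof -
  have "m_inv (BijGroup X) (m_inv (BijGroup X) g) = g"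
    using assms group.inv_inv[OF group_BijGroup, of g X] by (simp add: BijGroup_def)
  then show ?thesis using assms by (simp add: inv_BijGroup restrict_inv_into_Bij)
qed

context smooth_curve
begin

lemma eventually_in_X: "\<forall>\<^sub>F R in nhdsin (zar X) Q. R \<in> X" "\<forall>\<^sub>F R in atin (zar X) Q. R \<in> X"
proof -
  show "\<forall>\<^sub>F R in nhdsin (zar X) Q. R \<in> X"
    unfolding eventually_nhdsin using openin_topspace[of "zar X"] unfolding topspace_zar by blast
  then show "\<forall>\<^sub>F R in atin (zar X) Q. R \<in> X" by (simp add: eventually_nhdsin_atin)
qed

lemma morphism_in: "morphism X X \<phi> \<Longrightarrow> Q \<in> X \<Longrightarrow> \<phi> Q \<in> X"
  unfolding morphism_def continuous_map_def by force

lemma morphism_regular: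
  assumes "morphism X X \<phi>" "Q \<in> X" "regular_at X (\<phi> Q) f"
  shows "regular_at X Q (\<lambda>R. f (\<phi> R))"
proof -
  from morphism_in[OF assms(1,2)] regular_at_open[OF assms(3)] obtain U
    where "openin (zar X) U" "\<phi> Q \<in> U" "\<forall>R\<in>U. regular_at X R f" by auto
  with assms(1,2) have "regular_at X Q (f \<circ> \<phi>)"
    unfolding morphism_def by blast
  then show ?thesis by (simp add: o_def)
qed

lemma eventually_nhdsin_morphism:
  assumes "morphism X X \<phi>" "Q \<in> X" "eventually \<Phi> (nhdsin (zar X) (\<phi> Q))"
  shows "\<forall>\<^sub>F R in nhdsin (zar X) Q. \<Phi> (\<phi> R)"
proof -
  from assms(3) morphism_in[OF assms(1,2)] obtain U
    where U: "openin (zar X) U" "\<phi> Q \<in> U" "\<forall>R\<in>U. \<Phi> R" by (auto simp: eventually_nhdsin)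
  have "openin (zar X) {R \<in> topspace (zar X). \<phi> R \<in> U}"
    using assms(1) U(1) unfolding morphism_def by (intro openin_continuous_map_preimage) auto
  then show ?thesis
    unfolding eventually_nhdsin topspace_zar using U assms(2) by blast
qed

lemma eventually_atin_morphism:
  assumes "morphism X X \<phi>" "\<phi> \<in> Bij X" "Q \<in> X" "eventually \<Phi> (atin (zar X) (\<phi> Q))"
  shows "\<forall>\<^sub>F R in atin (zar X) Q. \<Phi> (\<phi> R)"
proof -
  have "\<forall>\<^sub>F R in nhdsin (zar X) (\<phi> Q). R \<noteq> \<phi> Q \<longrightarrow> \<Phi> R"
    unfolding eventually_nhdsin_atin using assms(4) by (auto elim: eventually_mono)
  from eventually_nhdsin_morphism[OF assms(1,3) this]
  have "\<forall>\<^sub>F R in atin (zar X) Q. \<phi> R \<noteq> \<phi> Q \<longrightarrow> \<Phi> (\<phi> R)"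
    by (simp add: eventually_nhdsin_atin)
  moreover have "\<forall>\<^sub>F R in atin (zar X) Q. R \<noteq> Q"
    unfolding eventually_atin using openin_topspace[of "zar X"] assms(3) unfolding topspace_zar by blast
  moreover note eventually_in_X(2)[of Q]
  ultimately show ?thesis
  proof eventually_elim
    case (elim R)
    then show ?case
      using assms(2,3) by (auto simp: Bij_def bij_betw_def dest: inj_onD)
  qed
qed

lemma morphism_id: "morphism X X (\<lambda>x\<in>X. x)"
  unfolding morphism_def
proof (intro conjI allI impI ballI)
  show "continuous_map (zar X) (zar X) (\<lambda>x\<in>X. x)"
    using continuous_map_eq[OF continuous_map_id, of "zar X" "\<lambda>x\<in>X. x"] by simp
next
  fix V h Q assume *: "openin (zar X) V" "\<forall>Q\<in>V. regular_at X Q h" "Q \<in> X" "(\<lambda>x\<in>X. x) Q \<in> V"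
  have "\<forall>\<^sub>F R in nhdsin (zar X) Q. (h \<circ> (\<lambda>x\<in>X. x)) R = h R"
    using eventually_in_X(1)[of Q] by eventually_elim simp
  moreover have "regular_at X Q h" using *(2-4) by simp
  ultimately show "regular_at X Q (h \<circ> (\<lambda>x\<in>X. x))"
    by (rule regular_at_cong[rotated])
qed

lemma morphism_compose:
  assumes "morphism X X \<phi>" "morphism X X \<psi>"
  shows "morphism X X (compose X \<phi> \<psi>)"
  unfolding morphism_def
proof (intro conjI allI impI ballI)
  have "continuous_map (zar X) (zar X) (\<phi> \<circ> \<psi>)"
    using assms by (intro continuous_map_compose[of _ "zar X"]) (simp_all add: morphism_def)
  then show "continuous_map (zar X) (zar X) (compose X \<phi> \<psi>)"
    by (rule continuous_map_eq) (simp add: compose_def)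
next
  fix V h Q assume *: "openin (zar X) V" "\<forall>Q\<in>V. regular_at X Q h" "Q \<in> X" "compose X \<phi> \<psi> Q \<in> V"
  then have "regular_at X (\<phi> (\<psi> Q)) h" by (simp add: compose_eq)
  then have "regular_at X (\<psi> Q) (\<lambda>R. h (\<phi> R))"
    by (rule morphism_regular[OF assms(1) morphism_in[OF assms(2) *(3)]])
  then have "regular_at X Q (\<lambda>R. h (\<phi> (\<psi> R)))"
    by (rule morphism_regular[OF assms(2) *(3)])
  moreover have "\<forall>\<^sub>F R in nhdsin (zar X) Q. (h \<circ> compose X \<phi> \<psi>) R = h (\<phi> (\<psi> R))"
    using eventually_in_X(1)[of Q] by eventually_elim (simp add: compose_eq)
  ultimately show "regular_at X Q (h \<circ> compose X \<phi> \<psi>)"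
    by (rule regular_at_cong)
qed

lemma subgroup_automorphisms: "subgroup (carrier (aut_group X)) (BijGroup X)"
proof (rule group.subgroupI[OF group_BijGroup])
  show "carrier (aut_group X) \<subseteq> carrier (BijGroup X)"
    by (auto simp: aut_group_simps BijGroup_def)
  have inv_id: "restrict (inv_into X (\<lambda>x\<in>X. x)) X = (\<lambda>x\<in>X. x)"
    using monoid.inv_one[OF group.is_monoid[OF group_BijGroup], of X] unfolding BijGroup_one inv_BijGroup[OF id_Bij] .
  have "(\<lambda>x\<in>X. x) \<in> carrier (aut_group X)"
    unfolding aut_group_simps(1) using morphism_id id_Bij[of X] inv_id by (metis (lifting) mem_Collect_eq)
  then show "carrier (aut_group X) \<noteq> {}" by blast
next
  fix g assume "g \<in> carrier (aut_group X)"
  then show "inv\<^bsub>BijGroup X\<^esub> g \<in> carrier (aut_group X)"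
    by (auto simp: aut_group_simps(1) inv_BijGroup restrict_inv_into_Bij restrict_inv_into_twice)
next
  fix g h assume gh: "g \<in> carrier (aut_group X)" "h \<in> carrier (aut_group X)"
  then have B: "g \<in> Bij X" "h \<in> Bij X" by (simp_all add: aut_group_simps)
  then have "inv\<^bsub>BijGroup X\<^esub> (g \<otimes>\<^bsub>BijGroup X\<^esub> h) = inv\<^bsub>BijGroup X\<^esub> h \<otimes>\<^bsub>BijGroup X\<^esub> inv\<^bsub>BijGroup X\<^esub> g"
    by (intro group.inv_mult_group group_BijGroup) (auto simp: BijGroup_def)
  then have "restrict (inv_into X (compose X g h)) X
      = compose X (restrict (inv_into X h) X) (restrict (inv_into X g) X)"
    using B by (simp add: BijGroup_mult inv_BijGroup restrict_inv_into_Bij compose_Bij)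
  then show "g \<otimes>\<^bsub>BijGroup X\<^esub> h \<in> carrier (aut_group X)"
    using gh B by (simp add: aut_group_simps(1) BijGroup_mult compose_Bij morphism_compose restrict_inv_into_Bij)
qed

text \<open>
  Automorphisms form a subgroup of all bijections, which provides the inverses and powers that are
  needed to use the order of \<open>G\<close>.
\<close>

lemma group_aut_group: "group (aut_group X)"
proof -
  have "aut_group X = (BijGroup X)\<lparr>carrier := carrier (aut_group X)\<rparr>"
    by (simp add: aut_group_def)
  then show ?thesis
    using group.subgroup_imp_group[OF group_BijGroup subgroup_automorphisms] by simp
qed

lemma inv_aut_group:
  assumes "g \<in> carrier (aut_group X)"
  shows "inv\<^bsub>aut_group X\<^esub> g = restrict (inv_into X g) X"
proof -
  have "aut_group X = (BijGroup X)\<lparr>carrier := carrier (aut_group X)\<rparr>"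
    by (simp add: aut_group_def)
  then have "inv\<^bsub>aut_group X\<^esub> g = inv\<^bsub>BijGroup X\<^esub> g"
    using group.m_inv_consistent[OF group_BijGroup subgroup_automorphisms assms] by simp
  then show ?thesis using assms by (simp add: inv_BijGroup aut_group_simps)
qed

lemma order_at_least_0:
  assumes "Q \<in> X"
  shows "order_at_least X Q f 0 \<longleftrightarrow>
    (\<exists>h. regular_at X Q h \<and> (\<forall>\<^sub>F R in atin (zar X) Q. f R = h R))"
proof -
  from assms obtain t where "local_parameter X Q t" using ex_local_parameter by blast
  then interpret Q: curve_point X Q t using assms by (rule curve_pointI)
  show ?thesis by (rule Q.order_at_least_0_iff)
qed

lemma order_at_least_0_pullback:
  assumes "g \<in> carrier (aut_group X)" "Q \<in> X" "order_at_least X (g Q) f 0"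
  shows "order_at_least X Q (\<lambda>R. f (g R)) 0"
proof -
  have g: "morphism X X g" "g \<in> Bij X" using assms(1) by (auto simp: aut_group_simps)
  from assms(3) obtain h where h: "regular_at X (g Q) h" "\<forall>\<^sub>F R in atin (zar X) (g Q). f R = h R"
    using order_at_least_0[OF morphism_in[OF g(1) assms(2)]] by blast
  show ?thesis
    unfolding order_at_least_0[OF assms(2)]
    using morphism_regular[OF g(1) assms(2) h(1)] eventually_atin_morphism[OF g assms(2) h(2)] by blast
qed

end

context curve_point
begin

text \<open>
  The automorphism \<open>s\<close> acts on the cotangent line at \<open>P\<close> by the scalar \<open>c\<close>.
\<close>

definition tangent :: "(('a, 'b) point \<Rightarrow> ('a, 'b) point) \<Rightarrow> 'b \<Rightarrow> bool" where
  "tangent s c \<longleftrightarrow> (\<exists>e. regular_at X P e \<and> e P = c \<and> near (\<lambda>Q. t (s Q) = t Q * e Q))"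

lemma near_X: "near (\<lambda>Q. Q \<in> X)"
  by (rule eventually_in_X)

context
  fixes s assumes s: "s \<in> carrier (aut_group X)" "s P = P"
begin

lemma regular_pullback: "regular_at X P f \<Longrightarrow> regular_at X P (\<lambda>Q. f (s Q))"
  using morphism_regular[of s P f] s P by (simp add: aut_group_simps)

lemma near_pullback: "near \<Phi> \<Longrightarrow> near (\<lambda>Q. \<Phi> (s Q))"
  using eventually_atin_morphism[of s P \<Phi>] s P by (simp add: aut_group_simps)

lemma ex_tangent: "\<exists>c. tangent s c"
proof -
  have "regular_at X P (\<lambda>Q. t (s Q))" "t (s P) = 0"
    using regular_pullback[OF regular_t] s(2) t_P by simp_all
  then obtain e where "regular_at X P e" "\<forall>\<^sub>F Q in nhdsin (zar X) P. t (s Q) = t Q * e Q"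
    by (rule factor_t)
  then show ?thesis unfolding tangent_def by (auto simp: eventually_nhdsin_atin)
qed

lemma tangent_compose:
  assumes "tangent s' c'" "tangent s c"
  shows "tangent (compose X s' s) (c' * c)"
proof -
  from assms obtain e e' where e: "regular_at X P e" "e P = c" "near (\<lambda>Q. t (s Q) = t Q * e Q)"
    and e': "regular_at X P e'" "e' P = c'" "near (\<lambda>Q. t (s' Q) = t Q * e' Q)"
    unfolding tangent_def by blast
  from e(3) near_pullback[OF e'(3)] near_X
  have "near (\<lambda>Q. t (compose X s' s Q) = t Q * (e' (s Q) * e Q))"
    by eventually_elim (simp add: compose_eq)
  moreover have "regular_at X P (\<lambda>Q. e' (s Q) * e Q)"
    by (intro regular_at_mult regular_pullback e e')
  moreover have "e' (s P) * e P = c' * c" using e e' s(2) by simp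
  ultimately show ?thesis unfolding tangent_def by (intro exI conjI)
qed

text \<open>
  If \<open>t \<circ> s = t e\<close> with \<open>e P = 1\<close> and \<open>f = h t\<^sup>n\<close>, then \<open>f \<circ> s - f = t\<^sup>n ((h \<circ> s) e\<^sup>n - h)\<close>, and the second
  factor is regular and vanishes at \<open>P\<close>: an automorphism that is trivial on the cotangent line
  does not change leading terms, for positive and negative \<open>n\<close> alike.
\<close>

lemma ord_ge_pullback_diff:
  assumes "tangent s 1" "ord_ge n f"
  shows "ord_ge (n + 1) (\<lambda>Q. f (s Q) - f Q)"
proof -
  from assms obtain e h where e: "regular_at X P e" "e P = 1" "near (\<lambda>Q. t (s Q) = t Q * e Q)"
    and h: "regular_at X P h" "near (\<lambda>Q. f Q = h Q * t Q powi n)"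
    unfolding tangent_def ord_ge_def by blast
  have "regular_at X P (\<lambda>Q. h (s Q) * e Q powi n - h Q)"
    using e(2) by (intro regular_at_diff regular_at_mult regular_at_power_int regular_pullback h e P sub_proj) simp
  then have "ord_ge 1 (\<lambda>Q. h (s Q) * e Q powi n - h Q)"
    by (rule regular_vanishing) (simp add: e(2) s(2))
  then have *: "ord_ge (n + 1) (\<lambda>Q. t Q powi n * (h (s Q) * e Q powi n - h Q))"
    by (rule ord_ge_mult[OF ord_ge_t])
  from h(2) near_pullback[OF h(2)] e(3)
  have "near (\<lambda>Q. f (s Q) - f Q = t Q powi n * (h (s Q) * e Q powi n - h Q))"
    by eventually_elim (simp add: power_int_mult_distrib algebra_simps)
  with * show ?thesis by (rule ord_ge_cong)
qed

lemma ord_ge_pullback: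
  assumes "tangent s 1" "ord_ge n f"
  shows "ord_ge n (\<lambda>Q. f (s Q))"
  using ord_ge_add[OF assms(2) ord_ge_mono[OF ord_ge_pullback_diff[OF assms], of n]] by simp

end

lemma tangent_unique: "tangent s c \<Longrightarrow> tangent s c' \<Longrightarrow> c = c'"
proof -
  assume "tangent s c" "tangent s c'"
  then obtain e e' where e: "regular_at X P e" "e P = c" "near (\<lambda>Q. t (s Q) = t Q * e Q)"
    and e': "regular_at X P e'" "e' P = c'" "near (\<lambda>Q. t (s Q) = t Q * e' Q)"
    unfolding tangent_def by blast
  from e(3) e'(3) t_nonzero have "near (\<lambda>Q. e Q = e' Q)"
    by eventually_elim simp
  from regular_values_agree[OF e(1) e'(1) this] e e' show "c = c'" by simp
qed

lemma tangent_id: "tangent (\<lambda>x\<in>X. x) 1"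
proof -
  from near_X have "near (\<lambda>Q. t ((\<lambda>x\<in>X. x) Q) = t Q * 1)"
    by eventually_elim simp
  then show ?thesis
    unfolding tangent_def using regular_at_const[of X P 1] by (intro exI[of _ "\<lambda>_. 1"] conjI) auto
qed

lemma tangent_pow:
  assumes "s \<in> carrier (aut_group X)" "s P = P" "tangent s c"
  shows "tangent (s [^]\<^bsub>aut_group X\<^esub> (n::nat)) (c ^ n)"
proof (induction n)
  case 0
  show ?case using tangent_id unfolding nat_pow_0 aut_group_simps(2) power_0 .
next
  case (Suc n)
  interpret A: group "aut_group X" by (rule group_aut_group)
  have "s [^]\<^bsub>aut_group X\<^esub> n \<in> carrier (aut_group X)" using assms(1) by simp
  then have "s [^]\<^bsub>aut_group X\<^esub> Suc n = compose X (s [^]\<^bsub>aut_group X\<^esub> n) s"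
    using assms(1) unfolding A.nat_pow_Suc by (intro aut_group_simps(3)) (auto simp only: aut_group_simps(1))
  with tangent_compose[OF assms(1,2) Suc assms(3)] show ?case by (simp add: mult.commute)
qed

end

section \<open>The decomposition group in the weakly ramified case\<close>

locale weakly_ramified_point = curve_point X P t
  for X :: "('n::finite, 'k::alg_closed_field) point set" and P t +
  fixes G :: "(('n, 'k) point \<Rightarrow> ('n, 'k) point) set"
  assumes char2: "CHAR('k) = 2"
    and subgroup_G: "subgroup G (aut_group X)"
    and card_G: "\<exists>r. card G = 2 ^ r"
    and weakly_ramified: "weakly_ramified X G"
begin

sublocale A: group "aut_group X"
  by (rule group_aut_group)

abbreviation D where "D \<equiv> decomposition_group G P"

lemma two_eq_0: "(2 :: 'k) = 0"
  using of_nat_CHAR[where ?'a = 'k] by (simp add: char2)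

lemma diff_eq_add: "x - y = x + (y :: 'k)"
  by (rule minus_CHAR_2[OF char2])

lemma diff_square: "(x - y)\<^sup>2 = x\<^sup>2 - (y :: 'k)\<^sup>2"
  by (simp add: diff_eq_add power2_sum two_eq_0)

lemma of_nat_odd: "odd n \<Longrightarrow> (of_nat n :: 'k) = 1"
  by (auto elim!: oddE simp: two_eq_0)

lemma D_aut: "s \<in> D \<Longrightarrow> s \<in> carrier (aut_group X)"
  and D_fix: "s \<in> D \<Longrightarrow> s P = P"
  using subgroup.subset[OF subgroup_G] by (auto simp: decomposition_group_def)

lemma D_Bij: "s \<in> D \<Longrightarrow> s \<in> Bij X"
  using D_aut by (auto simp: aut_group_simps(1))

lemma D_mult: "s \<in> D \<Longrightarrow> s' \<in> D \<Longrightarrow> s \<otimes>\<^bsub>aut_group X\<^esub> s' = compose X s s'"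
  by (intro aut_group_simps(3) D_Bij)

lemma subgroup_D: "subgroup D (aut_group X)"
proof (rule A.subgroupI)
  show "D \<subseteq> carrier (aut_group X)" using D_aut by blast
  have "\<one>\<^bsub>aut_group X\<^esub> \<in> D"
    using subgroup.one_closed[OF subgroup_G] P by (simp add: decomposition_group_def aut_group_simps(2))
  then show "D \<noteq> {}" by blast
next
  fix s assume s: "s \<in> D"
  then have "s \<in> G" by (simp add: decomposition_group_def)
  then have "inv\<^bsub>aut_group X\<^esub> s \<in> G" by (rule subgroup.m_inv_closed[OF subgroup_G])
  moreover have "inv_into X s P = P"
    using inv_into_f_f[of s X P] D_Bij[OF s] D_fix[OF s] P by (simp add: Bij_def bij_betw_def)
  ultimately show "inv\<^bsub>aut_group X\<^esub> s \<in> D"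
    using P D_aut[OF s] by (simp add: decomposition_group_def inv_aut_group)
next
  fix s s' assume s: "s \<in> D" "s' \<in> D"
  then have "s \<otimes>\<^bsub>aut_group X\<^esub> s' \<in> G"
    by (intro subgroup.m_closed[OF subgroup_G]) (simp_all add: decomposition_group_def)
  then show "s \<otimes>\<^bsub>aut_group X\<^esub> s' \<in> D"
    using s P by (simp add: decomposition_group_def aut_group_simps(3) D_mult compose_eq)
qed

lemma power_of_2_eq_1:
  assumes "(x :: 'k) ^ 2 ^ r = 1"
  shows "x = 1"
  using assms
proof (induction r arbitrary: x)
  case (Suc r)
  then have "(x ^ 2) ^ 2 ^ r = 1" by (simp add: power_mult)
  then have "x ^ 2 = 1" by (rule Suc.IH)
  then have "(x - 1) ^ 2 = 0" by (simp add: diff_square)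
  then show ?case by simp
qed simp

text \<open>
  The scalar by which \<open>s\<close> acts on the cotangent line is a root of unity of 2-power order, and 1 is
  the only one in characteristic 2. In other words, \<open>D\<close> coincides with its first ramification
  group.
\<close>

lemma tangent_1:
  assumes "s \<in> D"
  shows "tangent s 1"
proof -
  note s = D_aut[OF assms] D_fix[OF assms]
  obtain c where c: "tangent s c" using ex_tangent[OF s] by blast
  obtain r where r: "card G = 2 ^ r" using card_G by blast
  interpret G: group "(aut_group X)\<lparr>carrier := G\<rparr>"
    by (rule A.subgroup_imp_group[OF subgroup_G])
  have "s \<in> G" using assms by (simp add: decomposition_group_def)
  then have "s [^]\<^bsub>aut_group X\<^esub> card G = \<one>\<^bsub>aut_group X\<^esub>"
    using G.pow_order_eq_1[of s] by (simp add: order_def A.nat_pow_consistent[symmetric])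
  then have "tangent (\<lambda>x\<in>X. x) (c ^ card G)"
    using tangent_pow[OF s c, of "card G"] unfolding aut_group_simps(2) by metis
  then have "c ^ 2 ^ r = 1" using tangent_unique[OF tangent_id] r by metis
  then have "c = 1" by (rule power_of_2_eq_1)
  with c show ?thesis by simp
qed

lemma pullback_diff: "s \<in> D \<Longrightarrow> ord_ge n f \<Longrightarrow> ord_ge (n + 1) (\<lambda>Q. f (s Q) - f Q)"
  by (rule ord_ge_pullback_diff[OF D_aut D_fix tangent_1])

lemma pullback: "s \<in> D \<Longrightarrow> ord_ge n f \<Longrightarrow> ord_ge n (\<lambda>Q. f (s Q))"
  by (rule ord_ge_pullback[OF D_aut D_fix tangent_1])

text \<open>
  With \<open>z = 1/t\<close>, this says \<open>z \<circ> s = z + a + O(t)\<close>: up to higher order, \<open>s\<close> acts near the pole of \<open>z\<close>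
  as the translation by \<open>a\<close>. In terms of \<open>t\<close> this is the usual \<open>t \<circ> s = t - a t\<^sup>2 + O(t\<^sup>3)\<close>, but
  translations compose more simply, and functions with a pole at \<open>P\<close> expand in powers of \<open>z\<close>.
\<close>

definition shift :: "(('n, 'k) point \<Rightarrow> ('n, 'k) point) \<Rightarrow> 'k \<Rightarrow> bool" where
  "shift s a \<longleftrightarrow> ord_ge 1 (\<lambda>Q. inverse (t (s Q)) - inverse (t Q) - a)"

lemma inverse_t_power: "inverse (t Q) ^ n = t Q powi (- int n)"
  by (simp add: power_int_minus power_inverse)

lemma ord_ge_inverse_t_power: "ord_ge (- int n) (\<lambda>Q. inverse (t Q) ^ n)"
  unfolding inverse_t_power by (rule ord_ge_t)

lemma ord_ge_inverse_t: "ord_ge (-1) (\<lambda>Q. inverse (t Q))"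
  using ord_ge_inverse_t_power[of 1] by simp

lemma ord_ge_inverse_t_diff:
  assumes "s \<in> D"
  shows "ord_ge 0 (\<lambda>Q. inverse (t (s Q)) - inverse (t Q))"
  using pullback_diff[OF assms ord_ge_inverse_t] by simp

lemma ex_shift:
  assumes "s \<in> D"
  shows "\<exists>a. shift s a"
proof -
  obtain a where "ord_ge (0 + 1) (\<lambda>Q. inverse (t (s Q)) - inverse (t Q) - a * t Q powi 0)"
    using ord_ge_expand[OF ord_ge_inverse_t_diff[OF assms]] .
  then show ?thesis unfolding shift_def by auto
qed

lemma shift_compose:
  assumes "s \<in> D" "s' \<in> D" "shift s a" "shift s' a'"
  shows "shift (compose X s s') (a + a')"
proof -
  let ?z = "\<lambda>Q. inverse (t Q)"
  have "ord_ge 1 (\<lambda>Q. ?z (s (s' Q)) - ?z (s' Q) - a)"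
    using pullback[OF assms(2) assms(3)[unfolded shift_def]] .
  from ord_ge_add[OF this assms(4)[unfolded shift_def]]
  show ?thesis unfolding shift_def
    by (rule ord_ge_cong) (use near_X in eventually_elim, simp add: compose_eq)
qed

text \<open>
  From \<open>t \<circ> s - t = -(z \<circ> s - z) t (t \<circ> s)\<close> one reads off that a translation part 0 means
  \<open>t \<circ> s - t = O(t\<^sup>3)\<close>. As automorphisms act on functions through their inverses, this puts the
  inverse of \<open>s\<close> into the second ramification group, which is trivial.
\<close>

lemma shift_0:
  assumes "s \<in> D" "shift s 0"
  shows "s = \<one>\<^bsub>aut_group X\<^esub>"
proof -
  note s = D_aut[OF assms(1)] D_fix[OF assms(1)]
  have t1: "ord_ge 1 t" using ord_ge_t[of 1] by simp
  have "ord_ge (1 + 1 + 1) (\<lambda>Q. - 1 * ((inverse (t (s Q)) - inverse (t Q) - 0) * t Q * t (s Q)))"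
    using assms(2) unfolding shift_def
    by (intro ord_ge_cmult ord_ge_mult t1 pullback[OF assms(1) t1])
  moreover have "near (\<lambda>Q. t (s Q) - t Q = - 1 * ((inverse (t (s Q)) - inverse (t Q) - 0) * t Q * t (s Q)))"
    using t_nonzero near_pullback[OF s t_nonzero]
    by eventually_elim (simp add: field_simps)
  ultimately have "ord_ge (1 + 1 + 1) (\<lambda>Q. t (s Q) - t Q)"
    by (rule ord_ge_cong)
  then have "ord_ge 3 (\<lambda>Q. t (s Q) - t Q)" by simp
  then obtain h where h: "regular_at X P h" "near (\<lambda>Q. t (s Q) - t Q = h Q * t Q powi 3)"
    by (auto simp: ord_ge_def)
  \<comment> \<open>The definition of the ramification groups pulls back along \<^term>\<open>inv_into X g\<close>, so it speaks about \<open>s\<close> for \<open>g\<close> inverse to \<open>s\<close>.\<close>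
  define g where "g = inv\<^bsub>aut_group X\<^esub> s"
  have g: "g \<in> D" unfolding g_def by (rule subgroup.m_inv_closed[OF subgroup_D assms(1)])
  have inv_g: "inv_into X g Q = s Q" if "Q \<in> X" for Q
  proof -
    have "restrict (inv_into X g) X = s"
      using inv_aut_group[of g] D_aut[OF g] s(1) unfolding g_def by simp
    then show ?thesis using that by (metis restrict_apply')
  qed
  let ?d = "\<lambda>Q. t (inv_into X g Q) - t Q"
  have d_eq: "\<forall>\<^sub>F Q in nhdsin (zar X) P. ?d Q = t (s Q) - t Q"
    using eventually_in_X(1)[of P] by eventually_elim (simp add: inv_g)
  have "?d \<in> local_ideal X P (\<lambda>Q. t Q ^ (2 + 1))"
    unfolding local_ideal_def
  proof (intro CollectI conjI exI)
    show "regular_at X P ?d"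
      using regular_at_cong[OF regular_at_diff[OF regular_pullback[OF s regular_t] regular_t] d_eq] .
    have "\<forall>\<^sub>F Q in nhdsin (zar X) P. t (s Q) - t Q = t Q ^ (2 + 1) * h Q"
      using h(2) s(2) t_P by (simp add: eventually_nhdsin_atin mult.commute)
    with d_eq show "\<forall>\<^sub>F Q in nhdsin (zar X) P. ?d Q = t Q ^ (2 + 1) * h Q"
      by eventually_elim simp
  qed (fact h(1))
  with g t have "g \<in> ramification_group X G P 2"
    unfolding ramification_group_def by blast
  with weakly_ramified P have "g = \<one>\<^bsub>aut_group X\<^esub>"
    unfolding weakly_ramified_def by blast
  then show ?thesis
    unfolding g_def using s(1) by (metis A.inv_inv A.inv_one)
qed

text \<open>
  The translation part of \<open>s \<circ> s\<close> is \<open>2 a = 0\<close>.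
\<close>

lemma involution:
  assumes "s \<in> D" "Q \<in> X"
  shows "s (s Q) = Q"
proof -
  obtain a where a: "shift s a" using ex_shift[OF assms(1)] by blast
  have "a + a = 0" using diff_eq_add[of a a] by simp
  with shift_compose[OF assms(1,1) a a] have "shift (s \<otimes>\<^bsub>aut_group X\<^esub> s) 0"
    using D_mult assms(1) by simp
  then have "s \<otimes>\<^bsub>aut_group X\<^esub> s = \<one>\<^bsub>aut_group X\<^esub>"
    using shift_0 subgroup.m_closed[OF subgroup_D] assms(1) by blast
  then have "compose X s s Q = (\<lambda>x\<in>X. x) Q"
    unfolding aut_group_simps(2) D_mult[OF assms(1,1)] by simp
  then show ?thesis using assms(2) by (simp add: compose_eq)
qed

text \<open>
  If \<open>s\<close> and \<open>s'\<close> have equal translation parts, \<open>s \<circ> s'\<close> has translation part \<open>2 a = 0\<close>, so it is the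
  identity; but \<open>s'\<close> is its own inverse.
\<close>

lemma shift_inj:
  assumes "s \<in> D" "s' \<in> D" "shift s a" "shift s' a"
  shows "s = s'"
proof -
  have "a + a = 0" using diff_eq_add[of a a] by simp
  with shift_compose[OF assms] have "shift (s \<otimes>\<^bsub>aut_group X\<^esub> s') 0"
    using D_mult assms by simp
  then have ss': "s \<otimes>\<^bsub>aut_group X\<^esub> s' = \<one>\<^bsub>aut_group X\<^esub>"
    using shift_0 subgroup.m_closed[OF subgroup_D] assms by blast
  have "s Q = s' Q" if "Q \<in> X" for Q
  proof -
    have "s' Q \<in> X" using morphism_in that D_aut[OF assms(2)] by (auto simp: aut_group_simps(1))
    moreover have "compose X s s' (s' Q) = (\<lambda>x\<in>X. x) (s' Q)"
      using ss' unfolding aut_group_simps(2) D_mult[OF assms(1,2)] by simp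
    ultimately show ?thesis using involution[OF assms(2) that] by (simp add: compose_eq)
  qed
  then show ?thesis
    using D_Bij assms(1,2) by (intro extensionalityI[of _ X]) (auto simp: Bij_def)
qed

text \<open>
  A group that is not cyclic contains, besides the identity and a given element \<open>s\<close>, an element
  outside of the powers of \<open>s\<close>. By injectivity of the translation part, the two elements have
  distinct and nonzero translation parts.
\<close>

lemma ex_two_shifts:
  assumes "D \<noteq> {\<one>\<^bsub>aut_group X\<^esub>}" "\<not> cyclic_group ((aut_group X)\<lparr>carrier := D\<rparr>)"
  obtains s a s' a' where "s \<in> D" "shift s a" "s' \<in> D" "shift s' a'" "a \<noteq> 0" "a' \<noteq> 0" "a \<noteq> a'"
proof -
  have one: "\<one>\<^bsub>aut_group X\<^esub> \<in> D" by (rule subgroup.one_closed[OF subgroup_D])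
  with assms(1) obtain s where s: "s \<in> D" "s \<noteq> \<one>\<^bsub>aut_group X\<^esub>" by blast
  interpret D: group "(aut_group X)\<lparr>carrier := D\<rparr>"
    by (rule A.subgroup_imp_group[OF subgroup_D])
  let ?R = "range (\<lambda>n::int. s [^]\<^bsub>(aut_group X)\<lparr>carrier := D\<rparr>\<^esub> n)"
  have "?R \<subseteq> D" using D.int_pow_closed[of s] s(1) by auto
  moreover have "D \<noteq> ?R" using assms(2) s(1) unfolding D.cyclic_group by auto
  ultimately obtain s' where s': "s' \<in> D" "s' \<notin> ?R" by blast
  have R: "s [^]\<^bsub>(aut_group X)\<lparr>carrier := D\<rparr>\<^esub> n \<in> ?R" for n :: nat
    by (rule range_eqI[of _ _ "int n"]) (simp add: int_pow_int)
  have "s' \<noteq> \<one>\<^bsub>aut_group X\<^esub>" using s'(2) R[of 0] by auto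
  moreover have "s' \<noteq> s" using s'(2) R[of 1] s(1) D.nat_pow_eone[of s] by auto
  moreover obtain a a' where "shift s a" "shift s' a'" using ex_shift s(1) s'(1) by metis
  ultimately show thesis using that[of s a s' a'] s s' shift_0 shift_inj by metis
qed

section \<open>Expansion of functions at the ramified point\<close>

lemma power_shift:
  assumes "s \<in> D" "shift s a"
  shows "ord_ge (2 - int n) (\<lambda>Q. inverse (t (s Q)) ^ n - inverse (t Q) ^ n - of_nat n * a * inverse (t Q) ^ (n - 1))"
proof (cases "n = 0")
  case True
  then show ?thesis using ord_ge_zero by simp
next
  case False
  let ?z = "\<lambda>Q. inverse (t Q)"
  let ?B = "\<lambda>Q. ?z (s Q) - ?z Q"
  have "ord_ge (2 - int n) (\<lambda>Q. (?z Q + ?B Q) ^ n - ?z Q ^ n - of_nat n * ?z Q ^ (n - 1) * ?B Q)"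
    using ord_ge_binomial[of 1 ?z 0 ?B n] ord_ge_inverse_t ord_ge_inverse_t_diff[OF assms(1)] by simp
  moreover have "ord_ge (2 - int n) (\<lambda>Q. of_nat n * (?z Q ^ (n - 1) * (?B Q - a)))"
    using ord_ge_mult[OF ord_ge_inverse_t_power[of "n - 1"] assms(2)[unfolded shift_def]] False
    by (intro ord_ge_cmult) (simp add: of_nat_diff algebra_simps)
  ultimately have "ord_ge (2 - int n) (\<lambda>Q. ((?z Q + ?B Q) ^ n - ?z Q ^ n - of_nat n * ?z Q ^ (n - 1) * ?B Q)
      + of_nat n * (?z Q ^ (n - 1) * (?B Q - a)))"
    by (rule ord_ge_add)
  then show ?thesis by (rule ord_ge_cong) (simp add: algebra_simps)
qed

text \<open>
  By the Frobenius map, \<open>z\<^sup>2 \<circ> s = z\<^sup>2 + a\<^sup>2 + O(t\<^sup>2)\<close>. Therefore even powers of \<open>z\<close> are known two orders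
  beyond the leading term, although \<open>z \<circ> s\<close> itself is only known up to \<open>O(t)\<close>.
\<close>

lemma even_power_shift:
  assumes "s \<in> D" "shift s a"
  shows "ord_ge (4 - 2 * int j) (\<lambda>Q. inverse (t (s Q)) ^ (2 * j) - inverse (t Q) ^ (2 * j)
           - of_nat j * a\<^sup>2 * inverse (t Q) ^ (2 * (j - 1)))"
proof (cases "j = 0")
  case True
  then show ?thesis using ord_ge_zero by simp
next
  case False
  let ?z = "\<lambda>Q. inverse (t Q)"
  let ?B = "\<lambda>Q. (?z (s Q))\<^sup>2 - (?z Q)\<^sup>2"
  \<comment> \<open>In characteristic 2, squaring commutes with subtraction.\<close>
  have B: "?B Q - a\<^sup>2 = (?z (s Q) - ?z Q - a) * (?z (s Q) - ?z Q - a)" for Q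
    by (simp add: diff_square flip: power2_eq_square)
  have z2: "ord_ge (- 2) (\<lambda>Q. (?z Q)\<^sup>2)"
    using ord_ge_inverse_t_power[of 2] by simp
  have "ord_ge 2 (\<lambda>Q. ?B Q - a\<^sup>2)"
    unfolding B using ord_ge_mult[OF assms(2)[unfolded shift_def] assms(2)[unfolded shift_def]] by simp
  note B2 = this
  have "ord_ge 0 (\<lambda>Q. (?B Q - a\<^sup>2) + a\<^sup>2)"
    by (intro ord_ge_add ord_ge_mono[OF B2] ord_ge_regular regular_at_const) simp
  then have B0: "ord_ge 0 ?B" by simp
  have "ord_ge (4 - 2 * int j) (\<lambda>Q. ((?z Q)\<^sup>2 + ?B Q) ^ j - (?z Q)\<^sup>2 ^ j - of_nat j * (?z Q)\<^sup>2 ^ (j - 1) * ?B Q)"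
    using ord_ge_binomial[of 2 "\<lambda>Q. (?z Q)\<^sup>2" 0 ?B j] z2 B0 by (simp add: algebra_simps)
  moreover have "ord_ge (4 - 2 * int j) (\<lambda>Q. of_nat j * (?z Q ^ (2 * (j - 1)) * (?B Q - a\<^sup>2)))"
    using ord_ge_mult[OF ord_ge_inverse_t_power[of "2 * (j - 1)"] B2] False
    by (intro ord_ge_cmult) (simp add: of_nat_diff algebra_simps)
  ultimately have "ord_ge (4 - 2 * int j)
     (\<lambda>Q. (((?z Q)\<^sup>2 + ?B Q) ^ j - (?z Q)\<^sup>2 ^ j - of_nat j * (?z Q)\<^sup>2 ^ (j - 1) * ?B Q)
      + of_nat j * (?z Q ^ (2 * (j - 1)) * (?B Q - a\<^sup>2)))"
    by (rule ord_ge_add)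
  then show ?thesis
    by (rule ord_ge_cong) (simp add: algebra_simps flip: power_mult)
qed

text \<open>
  Passing from \<open>f\<close> to \<open>f \<circ> s - f\<close> acts on leading terms as \<open>a\<close> times the formal derivative in \<open>z\<close>;
  for odd \<open>m\<close> the factor \<open>m\<close> is 1.
\<close>

lemma first_difference:
  assumes "s \<in> D" "shift s a" "odd m"
    and f: "ord_ge (1 - int m) (\<lambda>Q. f Q - c * inverse (t Q) ^ m)"
  shows "ord_ge (2 - int m) (\<lambda>Q. f (s Q) - f Q - c * a * inverse (t Q) ^ (m - 1))"
proof -
  let ?z = "\<lambda>Q. inverse (t Q)"
  let ?r = "\<lambda>Q. f Q - c * ?z Q ^ m"
  have "ord_ge (2 - int m) (\<lambda>Q. ?r (s Q) - ?r Q)"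
    using pullback_diff[OF assms(1) f] by simp
  from ord_ge_add[OF this ord_ge_cmult[OF power_shift[OF assms(1,2), of m], of c]]
  show ?thesis
    by (rule ord_ge_cong) (simp add: of_nat_odd[OF assms(3)] algebra_simps)
qed

text \<open>
  On a leading term of even degree \<open>2 j\<close> the derivative vanishes, and the coefficient of degree
  \<open>2 j - 2\<close> receives \<open>a\<^sup>2 c\<close> from the leading term, as \<open>j\<close> is odd, and \<open>a d\<close> from the next one.
\<close>

lemma second_difference:
  assumes "s \<in> D" "shift s a" "odd j"
    and w: "ord_ge (2 - 2 * int j) (\<lambda>Q. w Q - c * inverse (t Q) ^ (2 * j) - d * inverse (t Q) ^ (2 * j - 1))"
  shows "ord_ge (3 - 2 * int j) (\<lambda>Q. w (s Q) - w Q - (c * a\<^sup>2 + d * a) * inverse (t Q) ^ (2 * j - 2))"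
proof -
  let ?z = "\<lambda>Q. inverse (t Q)"
  let ?r = "\<lambda>Q. w Q - c * ?z Q ^ (2 * j) - d * ?z Q ^ (2 * j - 1)"
  have j: "j \<ge> 1" using assms(3) by (cases j) auto
  have r: "ord_ge (3 - 2 * int j) (\<lambda>Q. ?r (s Q) - ?r Q)"
    using pullback_diff[OF assms(1) w] by simp
  have c: "ord_ge (3 - 2 * int j) (\<lambda>Q. c * (?z (s Q) ^ (2 * j) - ?z Q ^ (2 * j)
           - of_nat j * a\<^sup>2 * ?z Q ^ (2 * (j - 1))))"
    by (intro ord_ge_cmult ord_ge_mono[OF even_power_shift[OF assms(1,2)]]) simp
  have "ord_ge (2 - int (2 * j - 1)) (\<lambda>Q. d * (?z (s Q) ^ (2 * j - 1) - ?z Q ^ (2 * j - 1)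
           - of_nat (2 * j - 1) * a * ?z Q ^ (2 * j - 1 - 1)))"
    by (intro ord_ge_cmult power_shift assms(1,2))
  moreover have "2 - int (2 * j - 1) = 3 - 2 * int j" using j by (simp add: of_nat_diff)
  ultimately have d: "ord_ge (3 - 2 * int j) (\<lambda>Q. d * (?z (s Q) ^ (2 * j - 1) - ?z Q ^ (2 * j - 1)
           - of_nat (2 * j - 1) * a * ?z Q ^ (2 * j - 1 - 1)))"
    by simp
  have odd: "of_nat j = (1 :: 'k)" "of_nat (2 * j - 1) = (1 :: 'k)"
    using assms(3) j by (auto intro!: of_nat_odd)
  have exps: "2 * (j - 1) = 2 * j - 2" "2 * j - 1 - 1 = 2 * j - 2" by auto
  from ord_ge_add[OF r ord_ge_add[OF c d]] show ?thesis
    unfolding odd exps by (rule ord_ge_cong) (simp add: algebra_simps)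
qed

text \<open>
  The function \<open>w = f \<circ> s - f\<close> satisfies \<open>w \<circ> s - w = - 2 w = 0\<close>, since \<open>s\<close> is an involution. Comparing
  with the coefficient computed before shows that the second coefficient of \<open>w\<close> is determined by
  its leading coefficient \<open>c a\<close>: it must be \<open>c a\<^sup>2\<close>.
\<close>

lemma second_coefficient:
  assumes "s \<in> D" "shift s a" "a \<noteq> 0" "odd j"
    and f: "ord_ge (- 2 * int j) (\<lambda>Q. f Q - c * inverse (t Q) ^ (2 * j + 1))"
  shows "ord_ge (2 - 2 * int j) (\<lambda>Q. f (s Q) - f Q - c * a * inverse (t Q) ^ (2 * j)
           - c * a\<^sup>2 * inverse (t Q) ^ (2 * j - 1))"
proof -
  let ?z = "\<lambda>Q. inverse (t Q)"
  let ?w = "\<lambda>Q. f (s Q) - f Q"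
  have j: "j \<ge> 1" using assms(4) by (cases j) auto
  have "ord_ge (1 - 2 * int j) (\<lambda>Q. ?w Q - c * a * ?z Q ^ (2 * j))"
    using first_difference[OF assms(1,2), of "2 * j + 1" f c] f by simp
  then obtain d where "ord_ge (1 - 2 * int j + 1)
      (\<lambda>Q. ?w Q - c * a * ?z Q ^ (2 * j) - d * t Q powi (1 - 2 * int j))"
    by (rule ord_ge_expand)
  moreover have "t Q powi (1 - 2 * int j) = ?z Q ^ (2 * j - 1)" for Q
    unfolding inverse_t_power using j by (simp add: of_nat_diff)
  ultimately have w: "ord_ge (2 - 2 * int j)
      (\<lambda>Q. ?w Q - c * a * ?z Q ^ (2 * j) - d * ?z Q ^ (2 * j - 1))"
    by simp
  have "ord_ge (3 - 2 * int j) (\<lambda>Q. ?w (s Q) - ?w Q - (c * a * a\<^sup>2 + d * a) * ?z Q ^ (2 * j - 2))"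
    by (rule second_difference[OF assms(1,2,4) w])
  then have "ord_ge (3 - 2 * int j) (\<lambda>Q. (- (c * a * a\<^sup>2 + d * a)) * ?z Q ^ (2 * j - 2))"
  proof (rule ord_ge_cong)
    have zero: "f (s (s Q)) - f (s Q) - (f (s Q) - f Q) = 0" if "Q \<in> X" for Q
    proof -
      have "f (s (s Q)) - f (s Q) - (f (s Q) - f Q) = 2 * (f Q - f (s Q))"
        using involution[OF assms(1) that] by simp
      then show ?thesis by (simp only: two_eq_0 mult_zero_left)
    qed
    show "near (\<lambda>Q. - (c * a * a\<^sup>2 + d * a) * ?z Q ^ (2 * j - 2)
        = ?w (s Q) - ?w Q - (c * a * a\<^sup>2 + d * a) * ?z Q ^ (2 * j - 2))"
      using near_X
    proof eventually_elim
      case (elim Q)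
      show ?case unfolding zero[OF elim] by (simp only: diff_0 mult_minus_left)
    qed
  qed
  moreover have "?z Q ^ (2 * j - 2) = t Q powi (2 - 2 * int j)" for Q
    unfolding inverse_t_power using j by (simp add: of_nat_diff)
  ultimately have "ord_ge (2 - 2 * int j + 1) (\<lambda>Q. (- (c * a * a\<^sup>2 + d * a)) * t Q powi (2 - 2 * int j))"
    by simp
  from leading_coeff_zero[OF this] have "- (c * a * a\<^sup>2 + d * a) = 0" .
  moreover have "c * a * a\<^sup>2 + d * a = a * (c * a\<^sup>2 + d)"
    by (simp add: algebra_simps)
  ultimately have "a * (c * a\<^sup>2 + d) = 0"
    by simp
  then have "c * a\<^sup>2 + d = 0" using assms(3) by (simp only: mult_eq_0_iff) simp
  then have "c * a\<^sup>2 - d = 0" by (simp only: diff_eq_add)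
  then have "d = c * a\<^sup>2" by simp
  with w show ?thesis by (simp only:)
qed

section \<open>The smallest odd pole number\<close>

lemma has_order_imp_order_at_least: "has_order X P f n \<Longrightarrow> order_at_least X P f n"
  unfolding has_order_def order_at_least_def by blast

lemma poles_at_difference:
  assumes "s \<in> D" "\<And>Q. Q \<in> X - {P} \<Longrightarrow> order_at_least X Q f 0" "Q \<in> X - {P}"
  shows "order_at_least X Q (\<lambda>R. f (s R) - f R) 0"
proof -
  have "s Q \<in> X - {P}"
    using D_Bij[OF assms(1)] D_fix[OF assms(1)] assms(3) P
    by (auto simp: Bij_def bij_betw_def dest: inj_onD)
  then have "order_at_least X Q (\<lambda>R. f (s R)) 0"
    using order_at_least_0_pullback[OF D_aut[OF assms(1)]] assms(2,3) by blast
  from order_at_least_add[OF _ this assms(2)[OF assms(3)], of "-1"] assms(3) show ?thesis by simp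
qed

lemma pole_number_from_expansion:
  assumes "\<And>Q. Q \<in> X - {P} \<Longrightarrow> order_at_least X Q f 0"
    and "ord_ge (1 - int m) (\<lambda>Q. f Q - c * inverse (t Q) ^ m)" "c \<noteq> 0"
  shows "pole_number X P m"
proof -
  have "has_order X P f (- int m)"
    using has_order_leading_coeff[of "- int m" f c] assms(2,3) by (simp add: inverse_t_power)
  then show ?thesis
    using assms(1) has_order_imp_order_at_least by (intro pole_numberI[of f]) (auto simp: poles_at_def)
qed

text \<open>
  For odd \<open>m\<close> the function \<open>f \<circ> s - f\<close> has a pole of order \<open>m - 1 = 2 j\<close>. If \<open>j\<close> were odd,
  the coefficients of \<open>f \<circ> s - f\<close> in the degrees \<open>2 j\<close> and \<open>2 j - 1\<close> in \<open>z\<close> would be \<open>c a\<close> and \<open>c a\<^sup>2\<close>, and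
  likewise for \<open>s'\<close>. The linear combination that cancels the leading terms keeps the term of degree
  \<open>2 j - 1 = m - 2\<close>, because \<open>a \<noteq> a'\<close>: a smaller odd pole number.
\<close>

lemma smallest_odd_pole_number:
  assumes "s \<in> D" "shift s a" "s' \<in> D" "shift s' a'" "a \<noteq> 0" "a' \<noteq> 0" "a \<noteq> a'"
    and "odd m" and min: "\<And>n. odd n \<Longrightarrow> pole_number X P n \<Longrightarrow> m \<le> n"
    and hol: "\<And>Q. Q \<in> X - {P} \<Longrightarrow> order_at_least X Q f 0"
    and f: "ord_ge (1 - int m) (\<lambda>Q. f Q - c * inverse (t Q) ^ m)" "c \<noteq> 0"
  shows "[m = 1] (mod 4)" "pole_number X P (m - 1)"
proof -
  let ?z = "\<lambda>Q. inverse (t Q)"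
  have "1 - int (m - 1) = 2 - int m" using \<open>odd m\<close> by (cases m) auto
  with first_difference[OF assms(1,2,8) f(1)]
  show "pole_number X P (m - 1)"
    using assms(5) f(2) by (intro pole_number_from_expansion[OF poles_at_difference[OF assms(1) hol], where c = "c * a"]) auto
  obtain j where m: "m = 2 * j + 1" using \<open>odd m\<close> by (rule oddE)
  have "even j"
  proof (rule ccontr)
    assume j: "odd j"
    then have j1: "j \<ge> 1" by (cases j) auto
    have f': "ord_ge (- 2 * int j) (\<lambda>Q. f Q - c * ?z Q ^ (2 * j + 1))"
      using f(1) m by simp
    let ?w = "\<lambda>s Q. f (s Q) - f Q"
    let ?e = "\<lambda>s a Q. ?w s Q - c * a * ?z Q ^ (2 * j) - c * a\<^sup>2 * ?z Q ^ (2 * j - 1)"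
    \<comment> \<open>The coefficient of \<open>z\<close> to the power \<open>2 j\<close> is \<open>c a - (a / a') c a' = 0\<close>.\<close>
    define v where "v Q = ?w s Q + (- (a / a')) * ?w s' Q" for Q
    have "ord_ge (2 - 2 * int j) (\<lambda>Q. ?e s a Q + (- (a / a')) * ?e s' a' Q)"
      by (intro ord_ge_add ord_ge_cmult second_coefficient assms j f')
    moreover have "?e s a Q + (- (a / a')) * ?e s' a' Q = v Q - (c * a * (a - a')) * ?z Q ^ (2 * j - 1)" for Q
    proof -
      have "w - c * a * y - c * a\<^sup>2 * x + (- (a / a')) * (w' - c * a' * y - c * a'\<^sup>2 * x)
          = w + (- (a / a')) * w' - (c * a * (a - a')) * x" for w w' x y
        using assms(6) by (simp add: field_simps power2_eq_square)
      then show ?thesis by (simp only: v_def)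
    qed
    moreover have "2 - 2 * int j = 1 - int (2 * j - 1)" using j1 by (simp add: of_nat_diff)
    ultimately have v: "ord_ge (1 - int (2 * j - 1)) (\<lambda>Q. v Q - (c * a * (a - a')) * ?z Q ^ (2 * j - 1))"
      by (simp only:)
    have v_hol: "order_at_least X Q v 0" if "Q \<in> X - {P}" for Q
      unfolding v_def using that
      by (intro order_at_least_add poles_at_difference assms hol) auto
    have "c * a * (a - a') \<noteq> 0" using assms(5-7) f(2) by simp
    with v_hol v have "pole_number X P (2 * j - 1)"
      by (rule pole_number_from_expansion)
    with min[of "2 * j - 1"] m j1 show False by simp
  qed
  then show "[m = 1] (mod 4)"
    unfolding m cong_def by presburger
qed

end

theorem corollary5p3:
  fixes X :: "('n::finite, 'k::alg_closed_field) point set"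
    and G :: "(('n, 'k) point \<Rightarrow> ('n, 'k) point) set"
    and P :: "('n, 'k) point"
    and g :: nat
  assumes "CHAR('k) = 2"
    and "smooth_projective_curve X" and "has_genus X g" and "g \<ge> 2"
    and "subgroup G (aut_group X)" and "finite G" and "\<exists>r. card G = 2 ^ r"
    and "weakly_ramified X G"
    and "P \<in> X" and "ramified_at X G P"
    and "\<not> cyclic_group ((aut_group X)\<lparr>carrier := decomposition_group G P\<rparr>)"
  shows "\<exists>m. odd m \<and> pole_number X P m \<and> (\<forall>n. odd n \<and> pole_number X P n \<longrightarrow> m \<le> n) \<and>
           [m = 1] (mod 4) \<and> pole_number X P (m - 1)"
proof -
  interpret smooth_curve X by unfold_locales (fact assms(2))
  define m where "m = (LEAST m. odd m \<and> pole_number X P m)"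
  have "odd m \<and> pole_number X P m"
    unfolding m_def by (rule LeastI_ex[OF ex_odd_pole_number[OF assms(9,3)]])
  then have m: "odd m" "pole_number X P m" by simp_all
  have min: "m \<le> n" if "odd n" "pole_number X P n" for n
    unfolding m_def using that by (intro Least_le) simp
  obtain f where f: "has_order X P f (- int m)" "\<forall>Q\<in>X - {P}. order_at_least X Q f 0"
    using m(2) unfolding pole_number_def by blast
  then obtain t u where t: "local_parameter X P t" and u: "regular_at X P u" "u P \<noteq> 0"
    "\<forall>\<^sub>F Q in atin (zar X) P. f Q = u Q * t Q powi (- int m)"
    unfolding has_order_def by blast
  interpret weakly_ramified_point X P t G
    by (intro weakly_ramified_point.intro curve_point.intro curve_point_axioms.intro
        weakly_ramified_point_axioms.intro smooth_curve_axioms assms t)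
  have exp: "ord_ge (1 - int m) (\<lambda>Q. f Q - u P * inverse (t Q) ^ m)"
    using ord_ge_leading_coeff[OF u(1,3)] by (simp add: inverse_t_power)
  have "D \<noteq> {\<one>\<^bsub>aut_group X\<^esub>}"
    using assms(10) by (simp add: ramified_at_def)
  then obtain s a s' a' where s: "s \<in> D" "shift s a" "s' \<in> D" "shift s' a'" "a \<noteq> 0" "a' \<noteq> 0" "a \<noteq> a'"
    using ex_two_shifts assms(11) by metis
  from smallest_odd_pole_number[OF s m(1) min _ exp u(2)] f(2)
  have "[m = 1] (mod 4)" "pole_number X P (m - 1)" by blast+
  with m min show ?thesis by blast
qed

end
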